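(* Fix $k\ge1$ and $\pi\in\mathcal S_k$. Let $n\ge k$, let $\theta_1,\dots,\theta_n$ be positive reals, and let $\sigma_n\sim\mathrm{Luce}(\theta_1,\dots,\theta_n)$. Write $p_i:=p\left(\theta_{i+\pi^{-1}(1)},\dots,\theta_{i+\pi^{-1}(k)}\right)$ for $0\le i\le n-k$, and let $(\nu_n(\pi))^2:=\mathrm{Var}\left(\mathrm{c\text{-}occ}(\pi,\sigma_n)\right)$, $\nu_n(\pi)\ge 0$. Then $$(\nu_n(\pi))^2=\sum_{i=0}^{n-k}\left(p_i-p_i^2\right)+2\sum_{h=1}^{k-1}\sum_{i=0}^{n-k-h}\Big(\mathbb P\left(E_{i+\pi^{-1}(1)}<\dots<E_{i+\pi^{-1}(k)},\ E_{i+h+\pi^{-1}(1)}<\dots<E_{i+h+\pi^{-1}(k)}\right)-p_i\,p_{i+h}\Big),$$ where $E_1,\dots,E_n$ are independent exponential random variables of parameters $\theta_1,\dots,\theta_n$ respectively (empty sums are $0$). Moreover, if $\nu_n(\pi)>0$, then for every $w\in\mathbb R$, $$\left|\mathbb P\left(\frac{\mathrm{c\text{-}occ}(\pi,\sigma_n)-\mathbb E\left[\mathrm{c\text{-}occ}(\pi,\sigma_n)\right]}{\nu_n(\pi)}\le w\right)-\Phi(w)\right|\le 32(1+\sqrt6)\,\frac{nk^2}{(\nu_n(\pi))^3},$$ where $\Phi$ is the cumulative distribution function of the standard normal distribution.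
   Context: For positive reals $x_1,\dots,x_k$ with $w=x_1+\dots+x_k$, $$p(x_1,\dots,x_k):=\frac{x_1}{w}\cdot\frac{x_2}{w-x_1}\cdot\frac{x_3}{w-x_1-x_2}\cdots\frac{x_k}{x_k}.$$ $\mathcal S_n$ is the set of permutations of $[n]=\{1,\dots,n\}$. A random permutation $\sigma_n\in\mathcal S_n$ is $\mathrm{Luce}(\theta_1,\dots,\theta_n)$-distributed if $\mathbb P(\sigma_n=\sigma)=p(\theta_{\sigma^{-1}(1)},\dots,\theta_{\sigma^{-1}(n)})$ for all $\sigma\in\mathcal S_n$. For $\sigma\in\mathcal S_n$ and $I=\{i_1<\dots<i_k\}\subset[n]$, $\mathrm{pat}_I(\sigma)\in\mathcal S_k$ is the permutation with the same relative order as $\sigma(i_1),\dots,\sigma(i_k)$. For $\pi\in\mathcal S_k$, $\mathrm{c\text{-}occ}(\pi,\sigma):=\#\{I\subseteq[n]:\#I=k,\ I\text{ an interval of integers},\ \mathrm{pat}_I(\sigma)=\pi\}$. An exponential variable of parameter $\theta$ has mean $1/\theta$. *)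

theory Defs
  imports "HOL-Probability.Probability" "HOL-Combinatorics.Permutations"
begin

definition luce_p :: "nat \<Rightarrow> (nat \<Rightarrow> real) \<Rightarrow> real" where
  "luce_p k x = (\<Prod>j=1..k. x j / ((\<Sum>i=1..k. x i) - (\<Sum>i=1..<j. x i)))"

definition luce_distributed ::
  "'a measure \<Rightarrow> nat \<Rightarrow> (nat \<Rightarrow> real) \<Rightarrow> ('a \<Rightarrow> nat \<Rightarrow> nat) \<Rightarrow> bool" where
  "luce_distributed M n \<theta> X \<longleftrightarrow>
     X \<in> measurable M (count_space {\<tau>. \<tau> permutes {1..n}}) \<and>
     (\<forall>\<tau>. \<tau> permutes {1..n} \<longrightarrow>
        measure M {\<omega> \<in> space M. X \<omega> = \<tau>} = luce_p n (\<lambda>j. \<theta> (inv \<tau> j)))"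

(* ith I a is i_a, where I = {i_1 < ... < i_k}; positions are counted from 1. *)
definition ith :: "nat set \<Rightarrow> nat \<Rightarrow> nat" where
  "ith I a = sorted_list_of_set I ! (a - 1)"

(* Well defined when I is finite and \<sigma> is injective on I, see pat_ex1 below. *)
definition pat :: "nat set \<Rightarrow> (nat \<Rightarrow> nat) \<Rightarrow> (nat \<Rightarrow> nat)" where
  "pat I \<sigma> = (THE \<tau>. \<tau> permutes {1..card I} \<and>
     (\<forall>a\<in>{1..card I}. \<forall>b\<in>{1..card I}. \<tau> a < \<tau> b \<longleftrightarrow> \<sigma> (ith I a) < \<sigma> (ith I b)))"

definition c_occ :: "nat \<Rightarrow> (nat \<Rightarrow> nat) \<Rightarrow> nat \<Rightarrow> (nat \<Rightarrow> nat) \<Rightarrow> nat" where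
  "c_occ k \<pi> n \<sigma> =
     card {I. I \<subseteq> {1..n} \<and> card I = k \<and> (\<exists>a b. I = {a..b}) \<and> pat I \<sigma> = \<pi>}"

lemma permutes_same_order_ex1:
  fixes f :: "nat \<Rightarrow> nat"
  assumes inj: "inj_on f {1..k}"
  shows "\<exists>!\<tau>. \<tau> permutes {1..k} \<and>
           (\<forall>a\<in>{1..k}. \<forall>b\<in>{1..k}. \<tau> a < \<tau> b \<longleftrightarrow> f a < f b)"
proof -
  define r where "r a = (if a \<in> {1..k} then card {b\<in>{1..k}. f b \<le> f a} else a)" for a
  have less: "r a < r b" if "a \<in> {1..k}" "b \<in> {1..k}" "f a < f b" for a b
  proof -
    have "{c\<in>{1..k}. f c \<le> f a} \<subseteq> {c\<in>{1..k}. f c \<le> f b}"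
      and "b \<in> {c\<in>{1..k}. f c \<le> f b}" and "b \<notin> {c\<in>{1..k}. f c \<le> f a}"
      using that by auto
    then have "{c\<in>{1..k}. f c \<le> f a} \<subset> {c\<in>{1..k}. f c \<le> f b}" by blast
    then show ?thesis using that by (simp add: r_def psubset_card_mono)
  qed
  have ord: "r a < r b \<longleftrightarrow> f a < f b" if "a \<in> {1..k}" "b \<in> {1..k}" for a b
  proof -
    consider "f a < f b" | "a = b" | "f b < f a"
      using inj_onD[OF inj _ \<open>a \<in> {1..k}\<close> \<open>b \<in> {1..k}\<close>] by (metis linorder_neqE_nat)
    then show ?thesis
      using less[OF that] less[OF that(2,1)] by cases auto
  qed
  have injr: "inj_on r {1..k}"
  proof (rule inj_onI)
    fix a b assume ab: "a \<in> {1..k}" "b \<in> {1..k}" "r a = r b"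
    then have "f a = f b" using ord[of a b] ord[of b a] by simp
    then show "a = b" by (rule inj_onD[OF inj _ ab(1,2)])
  qed
  have sub: "r ` {1..k} \<subseteq> {1..k}"
  proof
    fix y assume "y \<in> r ` {1..k}"
    then obtain a where a: "a \<in> {1..k}" "y = r a" by auto
    have "card {b\<in>{1..k}. f b \<le> f a} \<le> card {1..k}" by (rule card_mono) auto
    moreover have "card {b\<in>{1..k}. f b \<le> f a} > 0"
      using a by (subst card_gt_0_iff) auto
    ultimately show "y \<in> {1..k}" using a by (simp add: r_def)
  qed
  have "bij_betw r {1..k} {1..k}"
    using injr sub by (simp add: bij_betw_def endo_inj_surj)
  then have "r permutes {1..k}" by (rule bij_imp_permutes) (auto simp: r_def)
  moreover have "\<tau> = r"
    if t: "\<tau> permutes {1..k}"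
      and o: "\<forall>a\<in>{1..k}. \<forall>b\<in>{1..k}. \<tau> a < \<tau> b \<longleftrightarrow> f a < f b" for \<tau>
  proof
    fix a show "\<tau> a = r a"
    proof (cases "a \<in> {1..k}")
      case True
      then have ta: "\<tau> a \<in> {1..k}" using permutes_in_image[OF t] by blast
      have "{b\<in>{1..k}. f b \<le> f a} = {b\<in>{1..k}. \<tau> b \<le> \<tau> a}"
      proof (rule Collect_cong)
        fix b
        have "f b \<le> f a \<longleftrightarrow> \<tau> b \<le> \<tau> a" if "b \<in> {1..k}"
        proof -
          have "\<tau> a < \<tau> b \<longleftrightarrow> f a < f b" using o True that by blast
          then show ?thesis by linarith
        qed
        then show "b \<in> {1..k} \<and> f b \<le> f a \<longleftrightarrow> b \<in> {1..k} \<and> \<tau> b \<le> \<tau> a"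
          by blast
      qed
      moreover have "\<tau> ` {b\<in>{1..k}. \<tau> b \<le> \<tau> a} = {1..\<tau> a}"
      proof
        show "\<tau> ` {b\<in>{1..k}. \<tau> b \<le> \<tau> a} \<subseteq> {1..\<tau> a}"
        proof
          fix y assume "y \<in> \<tau> ` {b\<in>{1..k}. \<tau> b \<le> \<tau> a}"
          then obtain b where b: "b \<in> {1..k}" "\<tau> b \<le> \<tau> a" "y = \<tau> b" by blast
          then have "\<tau> b \<in> {1..k}" using permutes_in_image[OF t] by blast
          with b show "y \<in> {1..\<tau> a}" by simp
        qed
        show "{1..\<tau> a} \<subseteq> \<tau> ` {b\<in>{1..k}. \<tau> b \<le> \<tau> a}"
        proof
          fix y assume "y \<in> {1..\<tau> a}"
          with ta have y: "y \<in> {1..k}" "y \<le> \<tau> a" by auto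
          then obtain b where "b \<in> {1..k}" "y = \<tau> b"
            using permutes_image[OF t] by (metis imageE)
          with y show "y \<in> \<tau> ` {b\<in>{1..k}. \<tau> b \<le> \<tau> a}" by auto
        qed
      qed
      moreover have "card (\<tau> ` {b\<in>{1..k}. \<tau> b \<le> \<tau> a}) = card {b\<in>{1..k}. \<tau> b \<le> \<tau> a}"
        by (intro card_image inj_on_subset[OF permutes_inj[OF t] subset_UNIV])
      ultimately show ?thesis using True by (simp add: r_def)
    next
      case False
      then show ?thesis using permutes_not_in[OF t False] by (simp only: r_def if_False)
    qed
  qed
  ultimately show ?thesis using ord by blast
qed

lemma pat_ex1:
  fixes \<sigma> :: "nat \<Rightarrow> nat"
  assumes "finite I" "inj_on \<sigma> I"
  shows "\<exists>!\<tau>. \<tau> permutes {1..card I} \<and>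
     (\<forall>a\<in>{1..card I}. \<forall>b\<in>{1..card I}. \<tau> a < \<tau> b \<longleftrightarrow> \<sigma> (ith I a) < \<sigma> (ith I b))"
proof (rule permutes_same_order_ex1[where f = "\<lambda>a. \<sigma> (ith I a)"], rule inj_onI)
  fix a b assume ab: "a \<in> {1..card I}" "b \<in> {1..card I}" "\<sigma> (ith I a) = \<sigma> (ith I b)"
  have len: "length (sorted_list_of_set I) = card I" by simp
  have in_I: "ith I c \<in> I" if "c \<in> {1..card I}" for c
  proof -
    have "c - 1 < length (sorted_list_of_set I)" using that len by simp linarith
    then have "ith I c \<in> set (sorted_list_of_set I)" unfolding ith_def by (rule nth_mem)
    then show ?thesis using assms(1) by simp
  qed
  have "ith I a = ith I b"
    by (rule inj_onD[OF assms(2) ab(3) in_I[OF ab(1)] in_I[OF ab(2)]])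
  moreover have "a - 1 < length (sorted_list_of_set I)" "b - 1 < length (sorted_list_of_set I)"
    using ab(1,2) len by (simp_all, linarith+)
  moreover have "distinct (sorted_list_of_set I)" by simp
  ultimately have "a - 1 = b - 1"
    unfolding ith_def using nth_eq_iff_index_eq by blast
  then show "a = b" using ab by auto
qed

end

theory Submission
  imports Defs
begin

text \<open>Attach to the positions \<open>1, \<dots>, n\<close> independent exponential clocks \<open>E\<^sub>a\<close> of rates \<open>\<theta> a\<close>. By
memorylessness, clocks \<open>a\<^sub>1, \<dots>, a\<^sub>m\<close> ring in this order with probability
\<open>\<Prod>\<^sub>j \<theta> a\<^sub>j / (\<theta> a\<^sub>j + \<dots> + \<theta> a\<^sub>m)\<close> (\<open>exponential_race\<close>), so the ranking of all clocks is a Luce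
permutation. A window \<open>i + 1, \<dots>, i + k\<close> of a permutation shows the pattern \<open>\<pi>\<close> exactly when its
values increase along \<open>i + inv \<pi> 1, \<dots>, i + inv \<pi> k\<close> (\<open>c_occ_eq_sum\<close>), which depends on the
ranking only through the order of the clocks of that window. Hence the number of occurrences has the
law of the number \<open>G\<close> of windows whose clocks ring in the prescribed order
(\<open>expectation_luce_eq\<close>). Windows at distance at least \<open>k\<close> use disjoint sets of clocks and are
independent; expanding the square of the centred sum and dropping the vanishing covariances is
the variance formula (\<open>expectation_S_sq_formula\<close>).

The normal approximation holds for every sum of \<open>n\<close> centred variables bounded by \<open>1\<close> in which
each one has a neighbourhood of at most \<open>D\<close> indices and far-apart groups are independent: with
\<open>\<epsilon> = n D\<^sup>2 / \<nu>\<^sup>3\<close> the Kolmogorov distance \<open>\<kappa>\<close> is at most \<open>112/5 \<epsilon>\<close> (\<open>discrepancy_le\<close>). The proof is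
Stein's method. The indicator of a half line is replaced by a continuous ramp \<open>h\<close> of width \<open>d\<close>,
which costs a constant times \<open>d\<close>, and \<open>h\<close> minus its normal mean is written as \<open>f' - w f\<close> with
bounded \<open>f\<close> and \<open>f'\<close>. Removing the neighbourhood of an index from \<open>W = S / \<nu>\<close> makes the rest
independent of that summand; a first-order expansion of \<open>f\<close> then leaves two errors
(\<open>stein_decomposition\<close>). The first is the fluctuation of \<open>\<Sum>\<^sub>i X\<^sub>i \<Sum>\<^sub>j X\<^sub>j / \<nu>\<^sup>2\<close>, with \<open>j\<close> in the
neighbourhood of \<open>i\<close>, around its mean \<open>1\<close>; a covariance count bounds it by a multiple of \<open>\<epsilon>\<close>. The
second is a Taylor remainder in which the steepness \<open>1 / d\<close> of the ramp occurs only on the event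
that \<open>W\<close> falls near the slope.

The probability of that event is estimated by the distance \<open>\<kappa>\<close> itself: it exceeds its normal value by
at most \<open>2 \<kappa>\<close>. For \<open>d\<close> of order \<open>\<epsilon>\<close> this gives \<open>\<kappa> \<le> C \<epsilon> + 2 \<epsilon> \<kappa> / d\<close>, and with \<open>d = 4 \<epsilon>\<close> the last term is
\<open>\<kappa> / 2\<close> and can be absorbed. So the rate is linear in \<open>\<epsilon>\<close>. For windows \<open>D = 2 k\<close> gives the
factor \<open>4 * 112/5 = 89.6\<close>, below \<open>32 * (1 + sqrt 6)\<close>.\<close>

section \<open>Tails of the normal density and the Stein equation\<close>

abbreviation \<phi> :: "real \<Rightarrow> real" where "\<phi> \<equiv> std_normal_density"

lemma std_normal_density_add:
  "\<phi> (w + t) = \<phi> w * (exp (- (w * t)) * exp (- t\<^sup>2 / 2))"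
proof -
  have "- ((w + t)\<^sup>2) / 2 = - w\<^sup>2 / 2 + (- (w * t) + - t\<^sup>2 / 2)"
    by (simp add: power2_eq_square field_simps)
  then show ?thesis
    by (simp only: std_normal_density_def exp_add mult.assoc)
qed

lemma std_normal_density_le: "\<phi> x \<le> 2 / 5"
proof -
  have "(5 / 2)\<^sup>2 \<le> 2 * pi" using pi_approx by (simp add: power2_eq_square)
  then have s: "5 / 2 \<le> sqrt (2 * pi)" by (rule real_le_rsqrt)
  have "\<phi> x \<le> 1 / sqrt (2 * pi)"
    by (auto simp: std_normal_density_def intro!: divide_right_mono)
  also have "\<dots> \<le> 1 / (5 / 2)" using s by (intro divide_left_mono) auto
  finally show ?thesis by simp
qed

lemma set_integrable_std_normal:
  "A \<in> sets borel \<Longrightarrow> set_integrable lborel A \<phi>"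
  unfolding set_integrable_def
  by (intro integrable_mult_indicator) (auto intro: integrable_normal_density)

definition upper_tail :: "real \<Rightarrow> real" where
  "upper_tail w = (LINT x:{w..}|lborel. \<phi> x)"

lemma upper_tail_shift: "upper_tail w = (\<integral>t. indicator {0..} t * \<phi> (w + t) \<partial>lborel)"
proof -
  have "upper_tail w = (\<integral>t. indicator {w..} (w + 1 * t) * \<phi> (w + 1 * t) \<partial>lborel)"
    unfolding upper_tail_def set_lebesgue_integral_def
    using lborel_integral_real_affine[of 1 "\<lambda>x. indicator {w..} x * \<phi> x" w] by simp
  also have "\<dots> = (\<integral>t. indicator {0..} t * \<phi> (w + t) \<partial>lborel)"
    by (intro Bochner_Integration.integral_cong) (auto simp: indicator_def)
  finally show ?thesis .
qed

lemma integrable_shifted_tail: "integrable lborel (\<lambda>t. indicator {0..} t * \<phi> (w + t))"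
proof -
  have "integrable lborel (\<lambda>t. \<phi> (w + 1 * t))"
    by (intro lborel_integrable_real_affine) (auto intro: integrable_normal_density)
  then show ?thesis
    using integrable_mult_indicator[of "{0..}" lborel "\<lambda>t. \<phi> (w + t)"] by simp
qed

text \<open>Translated to the half line, the tail integrates \<open>\<phi> w * exp (- (w t)) * exp (- t\<^sup>2 / 2)\<close>. Dropping
the factor \<open>exp (- (w t))\<close> leaves a Gaussian integral; dropping the other one, as in the next lemma,
leaves an exponential integral.\<close>

lemma upper_tail_le_density:
  assumes "w \<ge> 0"
  shows "upper_tail w \<le> 3 * \<phi> w"
proof -
  have "upper_tail w \<le> (\<integral>t. (\<phi> w * sqrt (2 * pi)) * \<phi> t \<partial>lborel)"
    unfolding upper_tail_shift
  proof (intro integral_mono integrable_shifted_tail)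
    show "integrable lborel (\<lambda>t. \<phi> w * sqrt (2 * pi) * \<phi> t)"
      by (intro integrable_mult_right integrable_normal_density) simp
    fix t :: real
    have "\<phi> (w + t) \<le> \<phi> w * exp (- t\<^sup>2 / 2)" if "t \<ge> 0"
      unfolding std_normal_density_add using assms that
      by (intro mult_left_mono) (auto simp: mult_le_cancel_right1)
    then show "indicator {0..} t * \<phi> (w + t) \<le> \<phi> w * sqrt (2 * pi) * \<phi> t"
      by (auto simp: indicator_def std_normal_density_def[of t])
  qed
  also have "\<dots> = \<phi> w * sqrt (2 * pi)" by simp
  also have "\<dots> \<le> \<phi> w * 3"
    using pi_less_4 by (intro mult_left_mono real_le_lsqrt) auto
  finally show ?thesis by simp
qed

lemma mult_upper_tail_le_density:
  assumes "w \<ge> 0"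
  shows "w * upper_tail w \<le> \<phi> w"
proof (cases "w = 0")
  case False
  with assms have w: "w > 0" by simp
  interpret E: prob_space "density lborel (exponential_density w)"
    by (rule prob_space_exponential_density[OF w])
  have one: "(\<integral>t. exponential_density w t \<partial>lborel) = 1"
    using E.prob_space w
    by (subst (asm) measure_def, subst (asm) emeasure_density)
       (auto simp: integral_eq_nn_integral exponential_density_nonneg)
  then have int: "integrable lborel (exponential_density w)"
    using not_integrable_integral_eq by force
  have "w * upper_tail w = (\<integral>t. w * (indicator {0..} t * \<phi> (w + t)) \<partial>lborel)"
    unfolding upper_tail_shift by simp
  also have "\<dots> \<le> (\<integral>t. \<phi> w * exponential_density w t \<partial>lborel)"
  proof (intro integral_mono integrable_mult_right integrable_shifted_tail int)
    fix t :: real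
    have "\<phi> (w + t) \<le> \<phi> w * exp (- (w * t))" if "t \<ge> 0"
      unfolding std_normal_density_add using assms that
      by (intro mult_left_mono) (auto simp: mult_le_cancel_left1)
    then show "w * (indicator {0..} t * \<phi> (w + t)) \<le> \<phi> w * exponential_density w t"
      using w by (auto simp: indicator_def exponential_density_def mult.commute mult.left_commute)
  qed
  also have "\<dots> = \<phi> w" using one by simp
  finally show ?thesis .
qed simp

lemma lower_tail_eq: "(LINT x:{..w}|lborel. \<phi> x) = upper_tail (- w)"
proof -
  have "(LINT x:{..w}|lborel. \<phi> x) = (\<integral>t. indicator {..w} (0 + -1 * t) * \<phi> (0 + -1 * t) \<partial>lborel)"
    unfolding set_lebesgue_integral_def
    using lborel_integral_real_affine[of "-1" "\<lambda>x. indicator {..w} x * \<phi> x" 0] by simp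
  also have "\<dots> = (\<integral>t. indicator {-w..} t * \<phi> t \<partial>lborel)"
    by (intro Bochner_Integration.integral_cong) (auto simp: indicator_def std_normal_density_def)
  finally show ?thesis by (simp add: upper_tail_def set_lebesgue_integral_def)
qed

definition normal_mean :: "(real \<Rightarrow> real) \<Rightarrow> real" where
  "normal_mean h = (\<integral>x. h x * \<phi> x \<partial>lborel)"

text \<open>The solution of the Stein equation \<open>f' w - w * f w = h w - normal_mean h\<close> that stays bounded at both
ends: multiplied by \<open>\<phi>\<close>, the equation says that \<open>f * \<phi>\<close> is a primitive of
\<open>(h - normal_mean h) * \<phi>\<close>.\<close>

definition stein_sol :: "(real \<Rightarrow> real) \<Rightarrow> real \<Rightarrow> real" where
  "stein_sol h w = (LINT x:{..w}|lborel. (h x - normal_mean h) * \<phi> x) / \<phi> w"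

locale stein_test =
  fixes h :: "real \<Rightarrow> real"
  assumes cont: "continuous_on UNIV h"
    and nonneg: "0 \<le> h x" and le_one: "h x \<le> 1"
begin

lemma meas [measurable]: "h \<in> borel_measurable borel"
  using cont by (rule borel_measurable_continuous_onI)

lemma integrable_test: "integrable lborel (\<lambda>x. h x * \<phi> x)"
  by (rule Bochner_Integration.integrable_bound[of _ "\<phi>"])
     (auto simp: abs_mult nonneg le_one mult_left_le_one_le intro: integrable_normal_density)

lemma normal_mean_bounds: "0 \<le> normal_mean h" "normal_mean h \<le> 1"
proof -
  show "0 \<le> normal_mean h" unfolding normal_mean_def
    by (intro integral_nonneg_AE) (auto simp: nonneg)
  have "normal_mean h \<le> (\<integral>x. \<phi> x \<partial>lborel)" unfolding normal_mean_def
    by (intro integral_mono integrable_test)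
       (auto simp: nonneg le_one mult_left_le_one_le intro: integrable_normal_density)
  then show "normal_mean h \<le> 1" by simp
qed

lemma centered_le_one: "\<bar>h x - normal_mean h\<bar> \<le> 1"
  using normal_mean_bounds nonneg[of x] le_one[of x] by linarith

definition weighted_dev where "weighted_dev x = (h x - normal_mean h) * \<phi> x"

lemma abs_weighted_dev_le: "\<bar>weighted_dev x\<bar> \<le> \<phi> x"
  unfolding weighted_dev_def abs_mult using centered_le_one by (simp add: mult_left_le_one_le)

lemma weighted_dev_meas [measurable]: "weighted_dev \<in> borel_measurable borel"
  unfolding weighted_dev_def[abs_def] by measurable

lemma integrable_weighted_dev: "integrable lborel weighted_dev"
  by (rule Bochner_Integration.integrable_bound[of _ "\<phi>"])
     (auto simp: abs_weighted_dev_le intro: integrable_normal_density)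

lemma set_integrable_weighted_dev: "A \<in> sets borel \<Longrightarrow> set_integrable lborel A weighted_dev"
  unfolding set_integrable_def by (intro integrable_mult_indicator integrable_weighted_dev) simp

lemma abs_set_integral_weighted_dev_le:
  assumes "A \<in> sets borel"
  shows "\<bar>LINT x:A|lborel. weighted_dev x\<bar> \<le> (LINT x:A|lborel. \<phi> x)"
proof -
  have "\<bar>LINT x:A|lborel. weighted_dev x\<bar> \<le> (LINT x:A|lborel. \<bar>weighted_dev x\<bar>)"
    using set_integral_norm_bound[OF set_integrable_weighted_dev[OF assms]] by simp
  also have "\<dots> \<le> (LINT x:A|lborel. \<phi> x)"
    using set_integrable_weighted_dev[OF assms] set_integrable_std_normal[OF assms] abs_weighted_dev_le
    by (intro set_integral_mono set_integrable_abs) auto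
  finally show ?thesis .
qed

lemma integral_weighted_dev_zero: "(\<integral>x. weighted_dev x \<partial>lborel) = 0"
proof -
  have "(\<integral>x. weighted_dev x \<partial>lborel) = (\<integral>x. h x * \<phi> x - normal_mean h * \<phi> x \<partial>lborel)"
    by (simp add: weighted_dev_def algebra_simps)
  also have "\<dots> = normal_mean h - normal_mean h * (\<integral>x. \<phi> x \<partial>lborel)"
    unfolding normal_mean_def
    by (subst Bochner_Integration.integral_diff)
       (auto intro: integrable_test integrable_normal_density)
  finally show ?thesis by simp
qed

text \<open>The integrand has total mass zero, so the primitive may be computed from either end. Taking the
end on the side of \<open>w\<close> bounds it by the smaller of the two Gaussian tails.\<close>

lemma abs_primitive_le: "\<bar>LINT x:{..w}|lborel. weighted_dev x\<bar> \<le> upper_tail \<bar>w\<bar>"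
proof (cases "w \<le> 0")
  case True
  then show ?thesis using abs_set_integral_weighted_dev_le[of "{..w}"] by (simp add: lower_tail_eq)
next
  case False
  have "(LINT x:{..w}|lborel. weighted_dev x) + (LINT x:{w<..}|lborel. weighted_dev x) = (LINT x:{..w} \<union> {w<..}|lborel. weighted_dev x)"
    by (rule set_integral_Un[symmetric]) (auto intro: set_integrable_weighted_dev)
  also have "{..w} \<union> {w<..} = UNIV" by auto
  also have "(LINT x:UNIV|lborel. weighted_dev x) = 0"
    using integral_weighted_dev_zero by (simp add: set_lebesgue_integral_def)
  finally have "\<bar>LINT x:{..w}|lborel. weighted_dev x\<bar> = \<bar>LINT x:{w<..}|lborel. weighted_dev x\<bar>" by simp
  also have "\<dots> \<le> (LINT x:{w<..}|lborel. \<phi> x)" by (rule abs_set_integral_weighted_dev_le) simp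
  also have "\<dots> \<le> upper_tail w"
    unfolding upper_tail_def set_lebesgue_integral_def
    using set_integrable_std_normal[of "{w<..}"] set_integrable_std_normal[of "{w..}"]
    by (intro integral_mono) (auto simp: set_integrable_def indicator_def)
  finally show ?thesis using False by simp
qed

lemma stein_sol_eq: "stein_sol h w = (LINT x:{..w}|lborel. weighted_dev x) / \<phi> w"
  by (simp add: stein_sol_def weighted_dev_def)

lemma abs_stein_sol_le: "\<bar>stein_sol h w\<bar> \<le> 3"
proof -
  have pos: "\<phi> w > 0" by (rule normal_density_pos) simp
  have "\<bar>LINT x:{..w}|lborel. weighted_dev x\<bar> \<le> 3 * \<phi> \<bar>w\<bar>"
    using abs_primitive_le upper_tail_le_density[of "\<bar>w\<bar>"] by (meson abs_ge_zero order_trans)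
  also have "\<phi> \<bar>w\<bar> = \<phi> w" by (simp add: std_normal_density_def)
  finally show ?thesis unfolding stein_sol_eq abs_divide using pos
    by (simp only: abs_of_pos divide_le_eq if_True)
qed

lemma abs_mult_stein_sol_le: "\<bar>w * stein_sol h w\<bar> \<le> 1"
proof -
  have pos: "\<phi> w > 0" by (rule normal_density_pos) simp
  have "\<bar>w\<bar> * \<bar>LINT x:{..w}|lborel. weighted_dev x\<bar> \<le> \<bar>w\<bar> * upper_tail \<bar>w\<bar>"
    by (intro mult_left_mono abs_primitive_le) auto
  also have "\<dots> \<le> \<phi> \<bar>w\<bar>" by (rule mult_upper_tail_le_density) simp
  also have "\<phi> \<bar>w\<bar> = \<phi> w" by (simp add: std_normal_density_def)
  finally show ?thesis unfolding stein_sol_eq using pos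
    by (simp only: abs_mult abs_divide abs_of_pos times_divide_eq_right divide_le_eq if_True mult_1)
qed

text \<open>Near \<open>w\<close> the primitive differs by a constant from the integral starting at \<open>w - 1\<close>, to which the
fundamental theorem applies because the integrand is continuous.\<close>

lemma DERIV_primitive: "((\<lambda>w. LINT x:{..w}|lborel. weighted_dev x) has_real_derivative weighted_dev w) (at w)"
proof -
  have cg: "continuous_on A weighted_dev" for A
    unfolding weighted_dev_def[abs_def] std_normal_density_def
    by (intro continuous_intros continuous_on_subset[OF cont]) auto
  have eq: "(LINT x:{..v}|lborel. weighted_dev x) = (LINT x:{..w - 1}|lborel. weighted_dev x) + integral {w - 1..v} weighted_dev"
    if "v \<in> {w - 1..w + 1}" for v
  proof -
    \<comment> \<open>The half-open interval keeps the union disjoint.\<close>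
    have "{..v} = {..w - 1} \<union> {w - 1<..v}" using that by auto
    then have "(LINT x:{..v}|lborel. weighted_dev x) = (LINT x:{..w - 1}|lborel. weighted_dev x) + (LINT x:{w - 1<..v}|lborel. weighted_dev x)"
      by (simp only:, intro set_integral_Un) (auto intro: set_integrable_weighted_dev)
    also have "(LINT x:{w - 1<..v}|lborel. weighted_dev x) = integral {w - 1<..v} weighted_dev"
      by (rule set_borel_integral_eq_integral(2)) (simp add: set_integrable_weighted_dev)
    also have "\<dots> = integral {w - 1..v} weighted_dev"
    proof (rule integral_spike_set)
      show "negligible {x \<in> {w - 1<..v} - {w - 1..v}. weighted_dev x \<noteq> 0}"
        by (rule negligible_subset[of "{}"]) auto
      show "negligible {x \<in> {w - 1..v} - {w - 1<..v}. weighted_dev x \<noteq> 0}"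
        by (rule negligible_subset[of "{w - 1}"]) auto
    qed
    finally show ?thesis .
  qed
  have "((\<lambda>v. integral {w - 1..v} weighted_dev) has_real_derivative weighted_dev w) (at w within {w - 1..w + 1})"
    by (rule integral_has_real_derivative) (auto intro: cg)
  from DERIV_add[OF DERIV_const this]
  have "((\<lambda>v. (LINT x:{..w - 1}|lborel. weighted_dev x) + integral {w - 1..v} weighted_dev) has_real_derivative weighted_dev w)
    (at w within {w - 1..w + 1})"
    by (simp only: add_0_left)
  moreover have "at w within {w - 1..w + 1} = at w"
    by (rule at_within_interior) simp
  ultimately have
    "((\<lambda>v. (LINT x:{..w - 1}|lborel. weighted_dev x) + integral {w - 1..v} weighted_dev) has_real_derivative weighted_dev w) (at w)"
    by (simp only:)
  then show ?thesis
  proof (rule has_field_derivative_transform_within_open[of _ _ _ "{w - 1<..<w + 1}"])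
    show "(LINT x:{..w - 1}|lborel. weighted_dev x) + integral {w - 1..v} weighted_dev = (LINT x:{..v}|lborel. weighted_dev x)"
      if "v \<in> {w - 1<..<w + 1}" for v
      using that by (intro eq[symmetric]) simp
  qed simp_all
qed

definition stein_deriv :: "real \<Rightarrow> real" where
  "stein_deriv w = h w - normal_mean h + w * stein_sol h w"

lemma DERIV_stein_sol: "(stein_sol h has_real_derivative stein_deriv w) (at w)"
proof -
  have pos: "\<phi> w \<noteq> 0" using normal_density_pos[of 1 0 w] by simp
  have d\<phi>: "(\<phi> has_real_derivative - w * \<phi> w) (at w)"
    unfolding std_normal_density_def[abs_def]
    by (auto intro!: derivative_eq_intros simp: field_simps)
  have "((\<lambda>w. (LINT x:{..w}|lborel. weighted_dev x) / \<phi> w) has_real_derivative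
      (weighted_dev w * \<phi> w - (LINT x:{..w}|lborel. weighted_dev x) * (- w * \<phi> w)) / (\<phi> w * \<phi> w)) (at w)"
    by (rule DERIV_divide[OF DERIV_primitive d\<phi> pos])
  also have "(weighted_dev w * \<phi> w - (LINT x:{..w}|lborel. weighted_dev x) * (- w * \<phi> w)) / (\<phi> w * \<phi> w)
      = stein_deriv w"
    using pos by (simp add: stein_deriv_def stein_sol_eq weighted_dev_def field_simps)
  finally show ?thesis by (simp add: stein_sol_eq[abs_def])
qed

end

section \<open>Ramps as test functions\<close>

text \<open>A continuous stand-in for the indicator of \<open>{..z}\<close>: it descends linearly from \<open>1\<close> at \<open>z\<close> to \<open>0\<close> at
\<open>z + d\<close>.\<close>

definition ramp :: "real \<Rightarrow> real \<Rightarrow> real \<Rightarrow> real" where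
  "ramp z d x = max 0 (min 1 ((z + d - x) / d))"

lemma ramp_eq_one: "d > 0 \<Longrightarrow> x \<le> z \<Longrightarrow> ramp z d x = 1"
  by (simp add: ramp_def)

lemma ramp_eq_zero: "d > 0 \<Longrightarrow> z + d \<le> x \<Longrightarrow> ramp z d x = 0"
  by (simp add: ramp_def divide_le_0_iff)

lemma stein_test_ramp: "d > 0 \<Longrightarrow> stein_test (ramp z d)"
  by unfold_locales (auto simp: ramp_def[abs_def] intro!: continuous_intros)

lemma abs_ramp_diff_le:
  assumes "d > 0"
  shows "\<bar>ramp z d x - ramp z d y\<bar> \<le> \<bar>x - y\<bar> / d"
proof -
  have "\<bar>ramp z d x - ramp z d y\<bar> \<le> \<bar>(z + d - x) / d - (z + d - y) / d\<bar>"
    unfolding ramp_def by linarith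
  also have "(z + d - x) / d - (z + d - y) / d = (y - x) / d"
    by (simp add: diff_divide_distrib)
  also have "\<bar>(y - x) / d\<bar> = \<bar>x - y\<bar> / d"
    using assms by (simp add: abs_divide abs_minus_commute)
  finally show ?thesis .
qed

text \<open>A move of length at most \<open>b\<close> changes the ramp only if it starts within \<open>b\<close> of the slope. Keeping
this indicator next to the Lipschitz constant \<open>1 / d\<close> is what later turns the steepness of the ramp
into a small probability.\<close>

lemma abs_ramp_diff_le_indicator:
  assumes d: "d > 0" and v: "\<bar>w - v\<bar> \<le> s" and s: "s \<le> b"
  shows "\<bar>ramp z d v - ramp z d w\<bar> \<le> s * (indicator {z - b<..z + d + b} w / d)"
proof (cases "w \<in> {z - b<..z + d + b}")
  case True
  have "\<bar>ramp z d v - ramp z d w\<bar> \<le> \<bar>v - w\<bar> / d" by (rule abs_ramp_diff_le[OF d])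
  also have "\<dots> \<le> s / d" using v d by (intro divide_right_mono) auto
  finally show ?thesis using True by simp
next
  case False
  then consider "w \<le> z - b" | "w > z + d + b" by force
  then have "ramp z d v = ramp z d w"
  proof cases
    case 1
    then show ?thesis using v s d by (simp add: ramp_eq_one)
  next
    case 2
    then show ?thesis using v s d by (simp add: ramp_eq_zero)
  qed
  then show ?thesis using False by simp
qed

context stein_test
begin

lemma abs_stein_deriv_le: "\<bar>stein_deriv w\<bar> \<le> 2"
  using centered_le_one[of w] abs_mult_stein_sol_le[of w] by (simp add: stein_deriv_def)

lemma stein_sol_meas [measurable]: "stein_sol h \<in> borel_measurable borel"
  by (intro borel_measurable_continuous_onI continuous_at_imp_continuous_on ballI
      DERIV_isCont[OF DERIV_stein_sol])

lemma stein_deriv_meas [measurable]: "stein_deriv \<in> borel_measurable borel"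
  unfolding stein_deriv_def[abs_def] by measurable

text \<open>The mean value theorem for steps of either sign, in the form in which a step of length \<open>s\<close> is taken
backwards from \<open>w\<close>.\<close>

lemma stein_mean_value:
  "\<exists>v. \<bar>w - v\<bar> \<le> \<bar>s\<bar> \<and> stein_sol h w - stein_sol h (w - s) = s * stein_deriv v"
proof -
  consider "s = 0" | "s > 0" | "s < 0" by linarith
  then show ?thesis
  proof cases
    case 1 then show ?thesis by (intro exI[of _ w]) simp
  next
    case 2
    then obtain v where "v > w - s" "v < w"
      "stein_sol h w - stein_sol h (w - s) = (w - (w - s)) * stein_deriv v"
      using MVT2[of "w - s" w "stein_sol h" stein_deriv] DERIV_stein_sol by auto
    then show ?thesis by (intro exI[of _ v]) simp
  next
    case 3
    then obtain v where "v > w" "v < w - s"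
      "stein_sol h (w - s) - stein_sol h w = (w - s - w) * stein_deriv v"
      using MVT2[of w "w - s" "stein_sol h" stein_deriv] DERIV_stein_sol by auto
    then show ?thesis by (intro exI[of _ v]) auto
  qed
qed

lemma abs_stein_sol_diff_le: "\<bar>stein_sol h w - stein_sol h v\<bar> \<le> 2 * \<bar>w - v\<bar>"
proof -
  obtain u where "stein_sol h w - stein_sol h (w - (w - v)) = (w - v) * stein_deriv u"
    using stein_mean_value by blast
  then show ?thesis
    using mult_left_mono[OF abs_stein_deriv_le[of u], of "\<bar>w - v\<bar>"] by (simp add: abs_mult)
qed

end

text \<open>The derivative of the solution is \<open>h w + w * f w\<close> up to a constant. Along a step of length at most
\<open>b\<close> the product \<open>w * f w\<close> varies by at most \<open>b * (2 * \<bar>w\<bar> + 3)\<close>, and the ramp only near its slope.\<close>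

lemma stein_ramp_taylor:
  assumes d: "d > 0" and s: "\<bar>s\<bar> \<le> b"
  shows "\<bar>stein_sol (ramp z d) w - stein_sol (ramp z d) (w - s) - s * stein_test.stein_deriv (ramp z d) w\<bar>
    \<le> b\<^sup>2 * (2 * \<bar>w\<bar> + 3 + indicator {z - b<..z + d + b} w / d)"
proof -
  interpret stein_test "ramp z d" by (rule stein_test_ramp[OF d])
  let ?f = "stein_sol (ramp z d)" and ?r = "2 * \<bar>w\<bar> + 3 + indicator {z - b<..z + d + b} w / d"
  obtain v where v: "\<bar>w - v\<bar> \<le> \<bar>s\<bar>" "?f w - ?f (w - s) = s * stein_deriv v"
    using stein_mean_value by blast
  have "v * ?f v - w * ?f w = w * (?f v - ?f w) + (v - w) * ?f v"
    by (simp add: algebra_simps)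
  also have "\<bar>\<dots>\<bar> \<le> \<bar>w\<bar> * (2 * \<bar>s\<bar>) + \<bar>s\<bar> * 3"
  proof (intro order_trans[OF abs_triangle_ineq] add_mono)
    show "\<bar>w * (?f v - ?f w)\<bar> \<le> \<bar>w\<bar> * (2 * \<bar>s\<bar>)"
      unfolding abs_mult using abs_stein_sol_diff_le[of v w] v(1)
      by (intro mult_left_mono) (auto simp: abs_minus_commute)
    show "\<bar>(v - w) * ?f v\<bar> \<le> \<bar>s\<bar> * 3"
      unfolding abs_mult using abs_stein_sol_le[of v] v(1)
      by (intro mult_mono) (auto simp: abs_minus_commute)
  qed
  finally have "\<bar>stein_deriv v - stein_deriv w\<bar>
      \<le> \<bar>w\<bar> * (2 * \<bar>s\<bar>) + \<bar>s\<bar> * 3 + \<bar>s\<bar> * (indicator {z - b<..z + d + b} w / d)"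
    using abs_ramp_diff_le_indicator[OF d v(1) s, of z] unfolding stein_deriv_def by linarith
  also have "\<dots> = \<bar>s\<bar> * ?r" by (simp add: algebra_simps)
  finally have "\<bar>s\<bar> * \<bar>stein_deriv v - stein_deriv w\<bar> \<le> \<bar>s\<bar> * (\<bar>s\<bar> * ?r)"
    by (rule mult_left_mono) simp
  also have "\<dots> \<le> b * (b * ?r)"
    using s d by (intro mult_mono) auto
  finally show ?thesis
    unfolding v(2) by (simp add: abs_mult[symmetric] right_diff_distrib power2_eq_square mult.assoc)
qed

lemma measure_std_normal:
  assumes [measurable]: "A \<in> sets borel"
  shows "measure std_normal_distribution A = (\<integral>x. indicator A x * \<phi> x \<partial>lborel)"
proof -
  have "measure std_normal_distribution A = (\<integral>x. indicator A x \<partial>std_normal_distribution)"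
    by simp
  also have "\<dots> = (\<integral>x. \<phi> x *\<^sub>R indicator A x \<partial>lborel)"
    by (rule integral_density) auto
  finally show ?thesis by (simp add: mult.commute)
qed

lemma cdf_std_normal_diff_le:
  assumes "a \<le> c"
  shows "cdf std_normal_distribution c - cdf std_normal_distribution a \<le> 2 / 5 * (c - a)"
proof -
  interpret N: real_distribution std_normal_distribution by (rule real_dist_normal_dist)
  have "cdf std_normal_distribution c - cdf std_normal_distribution a
      = measure std_normal_distribution {a<..c}"
  proof (cases "a = c")
    case False
    with assms show ?thesis by (intro N.cdf_diff_eq) simp
  qed simp
  also have "\<dots> = (\<integral>x. indicator {a<..c} x * \<phi> x \<partial>lborel)"
    by (rule measure_std_normal) simp
  also have "\<dots> \<le> (\<integral>x. indicator {a<..c} x * (2 / 5) \<partial>lborel)"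
  proof (rule integral_mono)
    show "integrable lborel (\<lambda>x. indicator {a<..c} x * \<phi> x)"
      using set_integrable_std_normal[of "{a<..c}"] by (simp add: set_integrable_def)
    show "integrable lborel (\<lambda>x. indicator {a<..c} x * (2 / 5 :: real))"
      using assms by (intro integrable_mult_left integrable_real_indicator) auto
  qed (intro mult_left_mono std_normal_density_le, simp)
  also have "\<dots> = 2 / 5 * (c - a)" using assms by simp
  finally show ?thesis .
qed

text \<open>The ramp lies between the indicators of \<open>{..z}\<close> and \<open>{..z + d}\<close>.\<close>

lemma cdf_le_normal_mean_ramp:
  assumes d: "d > 0"
  shows "cdf std_normal_distribution z \<le> normal_mean (ramp z d)"
    and "normal_mean (ramp z d) \<le> cdf std_normal_distribution (z + d)"
proof -
  interpret stein_test "ramp z d" by (rule stein_test_ramp[OF d])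
  have cdf: "cdf std_normal_distribution x = (\<integral>y. indicator {..x} y * \<phi> y \<partial>lborel)" for x
    unfolding cdf_def by (rule measure_std_normal) simp
  have int: "integrable lborel (\<lambda>y. indicator {..x} y * \<phi> y)" for x
    using set_integrable_std_normal[of "{..x}"] by (simp add: set_integrable_def)
  show "cdf std_normal_distribution z \<le> normal_mean (ramp z d)"
    unfolding cdf normal_mean_def using d nonneg
    by (intro integral_mono int integrable_test) (auto simp: indicator_def ramp_eq_one)
  show "normal_mean (ramp z d) \<le> cdf std_normal_distribution (z + d)"
    unfolding cdf normal_mean_def using d le_one
    by (intro integral_mono int integrable_test)
       (auto simp: indicator_def ramp_eq_zero mult_left_le_one_le nonneg)
qed

section \<open>Sums with dependency neighbourhoods\<close>

text \<open>A dependency graph whose vertices are the summands, given by closed neighbourhoods \<open>A i\<close>. Two sets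
of indices without an edge between them carry independent families; joint independence of the
families is needed, since products of two summands have to be decorrelated from each other and a
single summand from the whole sum outside its neighbourhood.\<close>

locale dependency_neighbourhoods = prob_space M for M :: "'a measure" +
  fixes I :: "'i set" and X :: "'i \<Rightarrow> 'a \<Rightarrow> real" and A :: "'i \<Rightarrow> 'i set" and D :: nat
  assumes fin: "finite I"
    and rv: "i \<in> I \<Longrightarrow> random_variable borel (X i)"
    and bounded: "i \<in> I \<Longrightarrow> \<omega> \<in> space M \<Longrightarrow> \<bar>X i \<omega>\<bar> \<le> 1"
    and centered: "i \<in> I \<Longrightarrow> expectation (X i) = 0"
    and nbhd: "i \<in> I \<Longrightarrow> A i \<subseteq> I"
    and nbhd_refl: "i \<in> I \<Longrightarrow> i \<in> A i"
    and nbhd_sym: "i \<in> I \<Longrightarrow> j \<in> A i \<Longrightarrow> i \<in> A j"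
    and card_nbhd: "i \<in> I \<Longrightarrow> card (A i) \<le> D"
    and indep: "K \<subseteq> I \<Longrightarrow> L \<subseteq> I \<Longrightarrow> (\<And>i. i \<in> K \<Longrightarrow> A i \<inter> L = {}) \<Longrightarrow>
      indep_var (PiM K (\<lambda>_. borel)) (\<lambda>\<omega>. \<lambda>i\<in>K. X i \<omega>) (PiM L (\<lambda>_. borel)) (\<lambda>\<omega>. \<lambda>i\<in>L. X i \<omega>)"
begin

lemma bounded_integrable:
  fixes Y :: "'a \<Rightarrow> real"
  assumes "random_variable borel Y" "\<And>\<omega>. \<omega> \<in> space M \<Longrightarrow> \<bar>Y \<omega>\<bar> \<le> B"
  shows "integrable M Y"
  using assms by (intro integrable_const_bound[of _ B]) auto

lemma abs_mult_le_one: "\<bar>x\<bar> \<le> 1 \<Longrightarrow> \<bar>y\<bar> \<le> 1 \<Longrightarrow> \<bar>x * y\<bar> \<le> (1::real)"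
  unfolding abs_mult using mult_mono[of "\<bar>x\<bar>" 1 "\<bar>y\<bar>" 1] by simp

lemma pair_in: "q \<in> Sigma I A \<Longrightarrow> fst q \<in> I \<and> snd q \<in> I"
proof (cases q)
  fix i j assume "q \<in> Sigma I A" "q = (i, j)"
  then have "i \<in> I" "j \<in> A i" by simp_all
  then show ?thesis using subsetD[OF nbhd[of i]] \<open>q = (i, j)\<close> by simp
qed

lemma finite_nbhd: "i \<in> I \<Longrightarrow> finite (A i)"
  using nbhd fin finite_subset by blast

text \<open>All uses of independence below have this shape: \<open>U\<close> and \<open>V\<close> are functions of two groups of
summands that are not adjacent.\<close>

lemma expectation_mult_indep:
  fixes u v :: "('i \<Rightarrow> real) \<Rightarrow> real"
  assumes K: "K \<subseteq> I" and L: "L \<subseteq> I" and sep: "\<And>i. i \<in> K \<Longrightarrow> A i \<inter> L = {}"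
    and u: "u \<in> borel_measurable (PiM K (\<lambda>_. borel))"
    and v: "v \<in> borel_measurable (PiM L (\<lambda>_. borel))"
    and U: "\<And>\<omega>. \<omega> \<in> space M \<Longrightarrow> U \<omega> = u (\<lambda>i\<in>K. X i \<omega>)"
    and V: "\<And>\<omega>. \<omega> \<in> space M \<Longrightarrow> V \<omega> = v (\<lambda>i\<in>L. X i \<omega>)"
    and intU: "integrable M U" and intV: "integrable M V"
  shows "expectation (\<lambda>\<omega>. U \<omega> * V \<omega>) = expectation U * expectation V"
proof -
  let ?u = "u \<circ> (\<lambda>\<omega>. \<lambda>i\<in>K. X i \<omega>)" and ?v = "v \<circ> (\<lambda>\<omega>. \<lambda>i\<in>L. X i \<omega>)"
  have "indep_var borel ?u borel ?v"
    by (rule indep_var_compose[OF indep[OF K L sep] u v])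
  moreover have "integrable M ?u" "integrable M ?v"
    using intU intV by (simp_all add: U V cong: Bochner_Integration.integrable_cong)
  ultimately have "expectation (\<lambda>\<omega>. ?u \<omega> * ?v \<omega>) = expectation ?u * expectation ?v"
    by (rule indep_var_lebesgue_integral)
  then show ?thesis by (simp add: U V cong: Bochner_Integration.integral_cong)
qed

definition S :: "'a \<Rightarrow> real" where "S \<omega> = (\<Sum>i\<in>I. X i \<omega>)"

lemma S_meas [measurable]: "random_variable borel S"
  unfolding S_def[abs_def] by (intro borel_measurable_sum rv)

lemma abs_sum_le_card:
  assumes "J \<subseteq> I" "\<omega> \<in> space M"
  shows "\<bar>\<Sum>j\<in>J. X j \<omega>\<bar> \<le> card J"
proof -
  have "\<bar>\<Sum>j\<in>J. X j \<omega>\<bar> \<le> (\<Sum>j\<in>J. 1)"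
    using assms bounded by (intro order_trans[OF sum_abs] sum_mono) auto
  then show ?thesis by simp
qed

lemma integrable_pair: "i \<in> I \<Longrightarrow> j \<in> I \<Longrightarrow> integrable M (\<lambda>\<omega>. X i \<omega> * X j \<omega>)"
  using bounded rv by (intro bounded_integrable[of _ 1] borel_measurable_times abs_mult_le_one) auto

lemma abs_expectation_pair_le:
  assumes "i \<in> I" "j \<in> I"
  shows "\<bar>expectation (\<lambda>\<omega>. X i \<omega> * X j \<omega>)\<bar> \<le> 1"
proof -
  have "\<bar>expectation (\<lambda>\<omega>. X i \<omega> * X j \<omega>)\<bar> \<le> expectation (\<lambda>\<omega>. \<bar>X i \<omega> * X j \<omega>\<bar>)"
    by (rule integral_abs_bound)
  also have "\<dots> \<le> 1"
    using bounded assms integrable_pair[OF assms]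
    by (intro integral_le_const AE_I2 abs_mult_le_one) auto
  finally show ?thesis .
qed

lemma expectation_pair_zero:
  assumes "i \<in> I" "j \<in> I" "j \<notin> A i"
  shows "expectation (\<lambda>\<omega>. X i \<omega> * X j \<omega>) = 0"
proof -
  have "expectation (\<lambda>\<omega>. X i \<omega> * X j \<omega>) = expectation (X i) * expectation (X j)"
    using assms bounded
    by (intro expectation_mult_indep[of "{i}" "{j}" "\<lambda>x. x i" "\<lambda>x. x j"] bounded_integrable[of _ 1] rv) auto
  then show ?thesis using assms by (simp add: centered)
qed

lemma expectation_S_sq:
  "expectation (\<lambda>\<omega>. (S \<omega>)\<^sup>2) = (\<Sum>(i,j)\<in>Sigma I A. expectation (\<lambda>\<omega>. X i \<omega> * X j \<omega>))"
proof -
  have "expectation (\<lambda>\<omega>. (S \<omega>)\<^sup>2) = expectation (\<lambda>\<omega>. \<Sum>i\<in>I. \<Sum>j\<in>I. X i \<omega> * X j \<omega>)"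
    by (simp add: S_def power2_eq_square sum_product)
  also have "\<dots> = (\<Sum>i\<in>I. \<Sum>j\<in>I. expectation (\<lambda>\<omega>. X i \<omega> * X j \<omega>))"
    by (simp add: Bochner_Integration.integral_sum integrable_pair)
  also have "\<dots> = (\<Sum>i\<in>I. \<Sum>j\<in>A i. expectation (\<lambda>\<omega>. X i \<omega> * X j \<omega>))"
    using fin nbhd by (intro sum.cong refl sum.mono_neutral_right) (auto simp: expectation_pair_zero)
  also have "\<dots> = (\<Sum>(i,j)\<in>Sigma I A. expectation (\<lambda>\<omega>. X i \<omega> * X j \<omega>))"
    using fin finite_nbhd by (intro sum.Sigma) auto
  finally show ?thesis .
qed

lemma card_pairs_le:
  assumes "J \<subseteq> I"
  shows "card (Sigma J A) \<le> card J * D"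
proof -
  have "card (Sigma J A) = (\<Sum>i\<in>J. card (A i))"
    using assms fin finite_nbhd by (intro card_SigmaI) (auto intro: finite_subset)
  also have "\<dots> \<le> card J * D" using assms card_nbhd by (intro sum_bounded_above[where K = D, simplified]) auto
  finally show ?thesis .
qed

lemma variance_S_le: "expectation (\<lambda>\<omega>. (S \<omega>)\<^sup>2) \<le> real (card I) * D"
proof -
  have "expectation (\<lambda>\<omega>. (S \<omega>)\<^sup>2) \<le> (\<Sum>(i,j)\<in>Sigma I A. 1)"
    unfolding expectation_S_sq using abs_expectation_pair_le nbhd
    by (intro sum_mono) (force simp: abs_le_iff)
  also have "\<dots> = real (card (Sigma I A))" by (simp add: case_prod_unfold)
  also have "\<dots> \<le> real (card I * D)" using card_pairs_le[of I] by (intro of_nat_mono) simp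
  finally show ?thesis by simp
qed

text \<open>The random counterpart of the variance: its expectation is the second moment of \<open>S\<close>, and Stein's
method needs it to be close to that mean.\<close>

definition T :: "'a \<Rightarrow> real" where "T \<omega> = (\<Sum>(i,j)\<in>Sigma I A. X i \<omega> * X j \<omega>)"

lemma T_meas [measurable]: "random_variable borel T"
  unfolding T_def[abs_def] case_prod_unfold
proof (rule borel_measurable_sum)
  fix q assume "q \<in> Sigma I A"
  then show "random_variable borel (\<lambda>\<omega>. X (fst q) \<omega> * X (snd q) \<omega>)"
    using pair_in rv by (intro borel_measurable_times) blast+
qed

lemma expectation_T: "expectation T = expectation (\<lambda>\<omega>. (S \<omega>)\<^sup>2)"
  unfolding expectation_S_sq T_def[abs_def] case_prod_unfold
proof (rule Bochner_Integration.integral_sum)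
  fix q assume "q \<in> Sigma I A"
  then show "integrable M (\<lambda>\<omega>. X (fst q) \<omega> * X (snd q) \<omega>)"
    using pair_in integrable_pair by blast
qed

definition cpair :: "'i \<times> 'i \<Rightarrow> 'a \<Rightarrow> real" where
  "cpair q \<omega> = X (fst q) \<omega> * X (snd q) \<omega> - expectation (\<lambda>\<omega>. X (fst q) \<omega> * X (snd q) \<omega>)"

text \<open>The pairs whose product may be correlated with the product belonging to \<open>q\<close>.\<close>

definition near :: "'i \<times> 'i \<Rightarrow> ('i \<times> 'i) set" where
  "near q = {r \<in> Sigma I A. {fst r, snd r} \<inter> (A (fst q) \<union> A (snd q)) \<noteq> {}}"

lemma cpair_meas: "q \<in> Sigma I A \<Longrightarrow> random_variable borel (cpair q)"
  unfolding cpair_def[abs_def] using pair_in[of q] rv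
  by (intro borel_measurable_diff borel_measurable_times borel_measurable_const) blast+

lemma abs_cpair_le:
  assumes "q \<in> Sigma I A" "\<omega> \<in> space M"
  shows "\<bar>cpair q \<omega>\<bar> \<le> 2"
proof -
  have "\<bar>X (fst q) \<omega> * X (snd q) \<omega>\<bar> \<le> 1"
    using bounded pair_in[OF assms(1)] assms(2) by (intro abs_mult_le_one) blast+
  then show ?thesis
    using abs_expectation_pair_le[of "fst q" "snd q"] pair_in[OF assms(1)] unfolding cpair_def by linarith
qed

lemma integrable_cpair: "q \<in> Sigma I A \<Longrightarrow> integrable M (cpair q)"
  by (intro bounded_integrable[of _ 2] cpair_meas abs_cpair_le)

lemma expectation_cpair: "q \<in> Sigma I A \<Longrightarrow> expectation (cpair q) = 0"
  unfolding cpair_def[abs_def] using pair_in[of q] integrable_pair[of "fst q" "snd q"]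
  by (simp add: prob_space)

lemma integrable_cpair_mult:
  assumes "q \<in> Sigma I A" "r \<in> Sigma I A"
  shows "integrable M (\<lambda>\<omega>. cpair q \<omega> * cpair r \<omega>)"
proof (rule bounded_integrable[of _ "2 * 2"])
  show "\<bar>cpair q \<omega> * cpair r \<omega>\<bar> \<le> 2 * 2" if "\<omega> \<in> space M" for \<omega>
    unfolding abs_mult using abs_cpair_le[OF assms(1) that] abs_cpair_le[OF assms(2) that]
    by (intro mult_mono) auto
qed (use assms cpair_meas in auto)

lemma expectation_cpair_sq_le:
  assumes "q \<in> Sigma I A"
  shows "expectation (\<lambda>\<omega>. (cpair q \<omega>)\<^sup>2) \<le> 1"
proof -
  let ?Y = "\<lambda>\<omega>. X (fst q) \<omega> * X (snd q) \<omega>"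
  have q: "fst q \<in> I" "snd q \<in> I" using pair_in[OF assms] by auto
  have Y: "\<bar>?Y \<omega>\<bar> \<le> 1" if "\<omega> \<in> space M" for \<omega>
    using bounded q that by (intro abs_mult_le_one) auto
  have sq: "(?Y \<omega>)\<^sup>2 \<le> 1" if "\<omega> \<in> space M" for \<omega>
    using Y[OF that] by (simp only: abs_square_le_1)
  have int: "integrable M (\<lambda>\<omega>. (?Y \<omega>)\<^sup>2)"
    using sq q by (intro bounded_integrable[of _ 1] borel_measurable_power borel_measurable_times rv) auto
  have "expectation (\<lambda>\<omega>. (cpair q \<omega>)\<^sup>2) = expectation (\<lambda>\<omega>. (?Y \<omega>)\<^sup>2) - (expectation ?Y)\<^sup>2"
    unfolding cpair_def using variance_eq[OF integrable_pair[OF q] int] by simp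
  also have "\<dots> \<le> expectation (\<lambda>\<omega>. (?Y \<omega>)\<^sup>2)" by simp
  also have "\<dots> \<le> 1" using sq int by (intro integral_le_const AE_I2)
  finally show ?thesis .
qed

lemma expectation_cpair_mult_le:
  assumes "q \<in> Sigma I A" "r \<in> Sigma I A"
  shows "expectation (\<lambda>\<omega>. cpair q \<omega> * cpair r \<omega>) \<le> 1"
proof -
  have int: "integrable M (\<lambda>\<omega>. (cpair p \<omega>)\<^sup>2)" if "p \<in> Sigma I A" for p
    using integrable_cpair_mult[OF that that] by (simp add: power2_eq_square)
  have "expectation (\<lambda>\<omega>. cpair q \<omega> * cpair r \<omega>)
      \<le> expectation (\<lambda>\<omega>. (cpair q \<omega>)\<^sup>2 / 2 + (cpair r \<omega>)\<^sup>2 / 2)"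
  proof (intro integral_mono integrable_cpair_mult assms)
    show "integrable M (\<lambda>\<omega>. (cpair q \<omega>)\<^sup>2 / 2 + (cpair r \<omega>)\<^sup>2 / 2)"
      using int assms by (intro Bochner_Integration.integrable_add integrable_divide) auto
    show "cpair q \<omega> * cpair r \<omega> \<le> (cpair q \<omega>)\<^sup>2 / 2 + (cpair r \<omega>)\<^sup>2 / 2" for \<omega>
      using sum_squares_bound[of "cpair q \<omega>" "cpair r \<omega>"] by (simp add: field_simps)
  qed
  also have "\<dots> = expectation (\<lambda>\<omega>. (cpair q \<omega>)\<^sup>2) / 2 + expectation (\<lambda>\<omega>. (cpair r \<omega>)\<^sup>2) / 2"
    using int assms by (subst Bochner_Integration.integral_add) auto
  also have "\<dots> \<le> 1" using expectation_cpair_sq_le[OF assms(1)] expectation_cpair_sq_le[OF assms(2)] by linarith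
  finally show ?thesis .
qed

lemma expectation_cpair_mult_zero:
  assumes q: "q \<in> Sigma I A" and r: "r \<in> Sigma I A" "r \<notin> near q"
  shows "expectation (\<lambda>\<omega>. cpair q \<omega> * cpair r \<omega>) = 0"
proof -
  let ?u = "\<lambda>p x. x (fst p) * x (snd p) - expectation (\<lambda>\<omega>. X (fst p) \<omega> * X (snd p) \<omega>)"
  have m: "?u p \<in> borel_measurable (PiM {fst p, snd p} (\<lambda>_. borel))" for p
    by (intro borel_measurable_diff borel_measurable_times measurable_component_singleton) auto
  have "expectation (\<lambda>\<omega>. cpair q \<omega> * cpair r \<omega>) = expectation (cpair q) * expectation (cpair r)"
    using q r pair_in[OF q] pair_in[OF r(1)] m
    by (intro expectation_mult_indep[of "{fst q, snd q}" "{fst r, snd r}" "?u q" "?u r"] integrable_cpair)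
       (auto simp: near_def cpair_def)
  then show ?thesis using q by (simp add: expectation_cpair)
qed

text \<open>A pair in \<open>near q\<close> has an entry in one of two neighbourhoods, hence at most \<open>2 D\<close> choices for that
entry and then \<open>D\<close> for the other; the factor \<open>2\<close> accounts for which entry it is. Symmetry of the
neighbourhoods reduces the second case to the first.\<close>

lemma card_near_le:
  assumes q: "q \<in> Sigma I A"
  shows "card (near q) \<le> 4 * D\<^sup>2"
proof -
  let ?J = "A (fst q) \<union> A (snd q)"
  have J: "?J \<subseteq> I" and fJ: "finite ?J" using pair_in[OF q] nbhd finite_nbhd by auto
  have cJ: "card ?J \<le> 2 * D"
    using card_Un_le[of "A (fst q)" "A (snd q)"] card_nbhd[of "fst q"] card_nbhd[of "snd q"]
      pair_in[OF q] by linarith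
  have fin': "finite (Sigma ?J A)" using fJ J finite_nbhd by (intro finite_SigmaI) auto
  have "near q \<subseteq> Sigma ?J A \<union> prod.swap ` Sigma ?J A"
  proof
    fix r assume "r \<in> near q"
    then have r: "fst r \<in> I" "snd r \<in> A (fst r)" "fst r \<in> ?J \<or> snd r \<in> ?J"
      by (auto simp: near_def)
    then have "r \<in> Sigma ?J A \<or> prod.swap r \<in> Sigma ?J A"
      using nbhd_sym[OF r(1,2)] by (cases r) auto
    then show "r \<in> Sigma ?J A \<union> prod.swap ` Sigma ?J A"
      by (metis UnI1 UnI2 image_eqI swap_swap)
  qed
  then have "card (near q) \<le> card (Sigma ?J A \<union> prod.swap ` Sigma ?J A)"
    using fin' by (intro card_mono) auto
  also have "\<dots> \<le> card (Sigma ?J A) + card (prod.swap ` Sigma ?J A)" by (rule card_Un_le)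
  also have "\<dots> \<le> 2 * card (Sigma ?J A)" using card_image_le[OF fin'] by simp
  also have "\<dots> \<le> 2 * (2 * D * D)"
    using card_pairs_le[OF J] mult_le_mono1[OF cJ, of D] by linarith
  finally show ?thesis by (simp add: power2_eq_square)
qed

text \<open>There are at most \<open>card I * D\<close> pairs, each with at most \<open>4 * D\<^sup>2\<close> correlated partners, and every
covariance is at most \<open>1\<close>.\<close>

lemma variance_T_le: "expectation (\<lambda>\<omega>. (T \<omega> - expectation T)\<^sup>2) \<le> 4 * real (card I) * real D ^ 3"
proof -
  let ?P = "Sigma I A"
  have finP: "finite ?P" using fin finite_nbhd by auto
  have T: "T \<omega> - expectation T = (\<Sum>q\<in>?P. cpair q \<omega>)" for \<omega>
    unfolding T_def expectation_T expectation_S_sq cpair_def by (simp add: case_prod_unfold sum_subtractf)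
  have "expectation (\<lambda>\<omega>. (T \<omega> - expectation T)\<^sup>2)
      = expectation (\<lambda>\<omega>. \<Sum>q\<in>?P. \<Sum>r\<in>?P. cpair q \<omega> * cpair r \<omega>)"
    unfolding T by (simp add: power2_eq_square sum_product)
  also have "\<dots> = (\<Sum>q\<in>?P. \<Sum>r\<in>?P. expectation (\<lambda>\<omega>. cpair q \<omega> * cpair r \<omega>))"
    by (simp add: Bochner_Integration.integral_sum integrable_cpair_mult)
  also have "\<dots> = (\<Sum>q\<in>?P. \<Sum>r\<in>near q. expectation (\<lambda>\<omega>. cpair q \<omega> * cpair r \<omega>))"
    using finP expectation_cpair_mult_zero
    by (intro sum.cong refl sum.mono_neutral_right) (auto simp: near_def)
  also have "\<dots> \<le> (\<Sum>q\<in>?P. \<Sum>r\<in>near q. 1)"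
    using expectation_cpair_mult_le by (intro sum_mono) (auto simp: near_def)
  also have "\<dots> \<le> (\<Sum>q\<in>?P. 4 * real D ^ 2)"
  proof (rule sum_mono)
    fix q assume "q \<in> ?P"
    from of_nat_mono[OF card_near_le[OF this], where 'a = real]
    show "(\<Sum>r\<in>near q. 1) \<le> 4 * real D ^ 2" by simp
  qed
  also have "\<dots> = real (card ?P) * (4 * real D ^ 2)" by simp
  also have "\<dots> \<le> real (card I * D) * (4 * real D ^ 2)"
    using card_pairs_le[of I] by (intro mult_right_mono of_nat_mono) auto
  finally show ?thesis by (simp add: power3_eq_cube power2_eq_square mult_ac)
qed

text \<open>Outside \<open>A i\<close> the sum is independent of the centred variable \<open>X i\<close>.\<close>

lemma expectation_mult_far_zero:
  fixes f :: "real \<Rightarrow> real"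
  assumes i: "i \<in> I" and f [measurable]: "f \<in> borel_measurable borel" and B: "\<And>x. \<bar>f x\<bar> \<le> B"
  shows "expectation (\<lambda>\<omega>. X i \<omega> * f ((S \<omega> - (\<Sum>j\<in>A i. X j \<omega>)) / c)) = 0"
proof -
  let ?v = "\<lambda>x. f ((\<Sum>j\<in>I - A i. x j) / c)"
  have S: "S \<omega> - (\<Sum>j\<in>A i. X j \<omega>) = (\<Sum>j\<in>I - A i. X j \<omega>)" for \<omega>
    unfolding S_def using fin nbhd[OF i] by (subst sum_diff) auto
  have m: "?v \<in> borel_measurable (PiM (I - A i) (\<lambda>_. borel))" by measurable
  have "expectation (\<lambda>\<omega>. X i \<omega> * f ((S \<omega> - (\<Sum>j\<in>A i. X j \<omega>)) / c))
      = expectation (X i) * expectation (\<lambda>\<omega>. f ((S \<omega> - (\<Sum>j\<in>A i. X j \<omega>)) / c))"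
  proof (rule expectation_mult_indep[of "{i}" "I - A i" "\<lambda>x. x i" ?v])
    show "integrable M (X i)" using bounded i by (intro bounded_integrable[of _ 1] rv) auto
    have "(\<lambda>\<omega>. \<Sum>j\<in>A i. X j \<omega>) \<in> borel_measurable M"
      using rv nbhd[OF i] by (intro borel_measurable_sum) auto
    then show "integrable M (\<lambda>\<omega>. f ((S \<omega> - (\<Sum>j\<in>A i. X j \<omega>)) / c))"
      using B by (intro bounded_integrable[of _ B]) auto
  qed (use i m S in auto)
  then show ?thesis using i by (simp add: centered)
qed

end

section \<open>A Berry--Esseen bound by bootstrapping\<close>

locale standardized_sum = dependency_neighbourhoods M I X A D
  for M :: "'a measure" and I :: "'i set" and X A D +
  fixes \<nu> :: real
  assumes nu_pos: "\<nu> > 0" and nu_sq: "\<nu>\<^sup>2 = expectation (\<lambda>\<omega>. (S \<omega>)\<^sup>2)"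
begin

definition W :: "'a \<Rightarrow> real" where "W \<omega> = S \<omega> / \<nu>"

definition \<eta> :: "'i \<Rightarrow> 'a \<Rightarrow> real" where "\<eta> i \<omega> = (\<Sum>j\<in>A i. X j \<omega>) / \<nu>"

definition eps :: real where "eps = real (card I) * (real D)\<^sup>2 / \<nu> ^ 3"

lemma W_meas [measurable]: "random_variable borel W"
  unfolding W_def[abs_def] by measurable

lemma eta_meas:
  assumes "i \<in> I" shows "random_variable borel (\<eta> i)"
proof -
  have "(\<lambda>\<omega>. \<Sum>j\<in>A i. X j \<omega>) \<in> borel_measurable M"
    using rv nbhd[OF assms] by (intro borel_measurable_sum) auto
  then show ?thesis unfolding \<eta>_def[abs_def] by simp
qed

lemma abs_W_le: "\<omega> \<in> space M \<Longrightarrow> \<bar>W \<omega>\<bar> \<le> card I / \<nu>"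
  using abs_sum_le_card[of I \<omega>] nu_pos by (simp add: W_def S_def abs_divide divide_right_mono)

lemma abs_eta_le:
  assumes "i \<in> I" "\<omega> \<in> space M"
  shows "\<bar>\<eta> i \<omega>\<bar> \<le> D / \<nu>"
proof -
  have "\<bar>\<Sum>j\<in>A i. X j \<omega>\<bar> \<le> real D"
    using abs_sum_le_card[OF nbhd[OF assms(1)] assms(2)] card_nbhd[OF assms(1)] by linarith
  then show ?thesis using nu_pos by (simp add: \<eta>_def abs_divide divide_right_mono)
qed

lemma nu_sq_le: "\<nu>\<^sup>2 \<le> real (card I) * D"
  unfolding nu_sq by (rule variance_S_le)

text \<open>A neighbourhood moves \<open>W\<close> by at most \<open>D / \<nu>\<close>. Since \<open>\<nu>\<^sup>2 \<le> card I * D\<close>, this displacement is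
at most \<open>eps\<close>, so that every error term can be expressed through \<open>eps\<close> alone.\<close>

lemma D_div_nu_le: "D / \<nu> \<le> eps"
proof -
  have "D / \<nu> = (D * \<nu>\<^sup>2) / \<nu> ^ 3"
    using nu_pos by (simp add: power3_eq_cube power2_eq_square)
  also have "\<dots> \<le> (D * (real (card I) * D)) / \<nu> ^ 3"
    using nu_sq_le nu_pos by (intro divide_right_mono mult_left_mono) auto
  also have "\<dots> = eps" by (simp add: eps_def power2_eq_square mult_ac)
  finally show ?thesis .
qed

lemma eps_pos: "eps > 0"
proof -
  have "0 < real (card I) * D" using nu_sq_le nu_pos by (smt (verit) zero_less_power)
  then have "0 < D" by (auto simp: zero_less_mult_iff)
  then have "0 < D / \<nu>" using nu_pos by simp
  then show ?thesis using D_div_nu_le by linarith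
qed

lemma integrable_W_sq: "integrable M (\<lambda>\<omega>. (W \<omega>)\<^sup>2)"
proof (rule bounded_integrable)
  show "\<bar>(W \<omega>)\<^sup>2\<bar> \<le> (card I / \<nu>)\<^sup>2" if "\<omega> \<in> space M" for \<omega>
    using power_mono[OF abs_W_le[OF that], of 2] by simp
qed simp

lemma integrable_abs_W: "integrable M (\<lambda>\<omega>. \<bar>W \<omega>\<bar>)"
  using abs_W_le by (intro bounded_integrable[of _ "card I / \<nu>"]) auto

lemma expectation_W_sq: "expectation (\<lambda>\<omega>. (W \<omega>)\<^sup>2) = 1"
  using nu_pos by (simp add: W_def power_divide nu_sq[symmetric])

lemma expectation_abs_W_le: "expectation (\<lambda>\<omega>. \<bar>W \<omega>\<bar>) \<le> 1"
proof -
  have "expectation (\<lambda>\<omega>. \<bar>W \<omega>\<bar>) \<le> expectation (\<lambda>\<omega>. (1 + (W \<omega>)\<^sup>2) / 2)"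
  proof (intro integral_mono integrable_abs_W)
    show "integrable M (\<lambda>\<omega>. (1 + (W \<omega>)\<^sup>2) / 2)"
      using integrable_W_sq by simp
    show "\<bar>W \<omega>\<bar> \<le> (1 + (W \<omega>)\<^sup>2) / 2" for \<omega>
      using sum_squares_bound[of 1 "\<bar>W \<omega>\<bar>"] by simp
  qed
  also have "\<dots> = 1" using integrable_W_sq by (simp add: expectation_W_sq prob_space)
  finally show ?thesis .
qed

lemma abs_T_le: "\<omega> \<in> space M \<Longrightarrow> \<bar>T \<omega>\<bar> \<le> card (Sigma I A)"
proof -
  assume w: "\<omega> \<in> space M"
  have "\<bar>T \<omega>\<bar> \<le> (\<Sum>q\<in>Sigma I A. \<bar>X (fst q) \<omega> * X (snd q) \<omega>\<bar>)"
    unfolding T_def case_prod_unfold by (rule sum_abs)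
  also have "\<dots> \<le> (\<Sum>q\<in>Sigma I A. 1)"
    by (intro sum_mono abs_mult_le_one bounded conjunct1[OF pair_in] conjunct2[OF pair_in] w)
  finally show ?thesis by simp
qed

lemma integrable_T: "integrable M T"
  using abs_T_le by (rule bounded_integrable[OF T_meas])

text \<open>The second moment of \<open>1 - T / \<nu>\<^sup>2\<close> is at most \<open>(4 * eps) * (D / \<nu>)\<close>, hence at most \<open>4 * eps\<^sup>2\<close>. The
arithmetic-geometric inequality with weight \<open>2 * eps\<close>, the resulting bound for the root mean square, passes
from the second to the first absolute moment.\<close>

lemma expectation_abs_one_minus_T_le: "expectation (\<lambda>\<omega>. \<bar>1 - T \<omega> / \<nu>\<^sup>2\<bar>) \<le> 2 * eps"
proof -
  let ?Y = "\<lambda>\<omega>. 1 - T \<omega> / \<nu>\<^sup>2"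
  have Y: "?Y \<omega> = - (T \<omega> - expectation T) / \<nu>\<^sup>2" for \<omega>
    using nu_pos by (simp add: expectation_T nu_sq[symmetric] field_simps)
  have int: "integrable M (\<lambda>\<omega>. (?Y \<omega>)\<^sup>2)"
  proof (rule bounded_integrable)
    fix \<omega> assume "\<omega> \<in> space M"
    then have "\<bar>T \<omega>\<bar> / \<nu>\<^sup>2 \<le> card (Sigma I A) / \<nu>\<^sup>2" using abs_T_le nu_pos by (intro divide_right_mono) auto
    then have "\<bar>?Y \<omega>\<bar> \<le> 1 + card (Sigma I A) / \<nu>\<^sup>2"
      using abs_triangle_ineq4[of 1 "T \<omega> / \<nu>\<^sup>2"] by (simp add: abs_divide)
    then show "\<bar>(?Y \<omega>)\<^sup>2\<bar> \<le> (1 + card (Sigma I A) / \<nu>\<^sup>2)\<^sup>2"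
      by (simp add: abs_le_square_iff[symmetric])
  qed simp
  have nu0: "\<nu> \<noteq> 0" using nu_pos by simp
  have "expectation (\<lambda>\<omega>. (?Y \<omega>)\<^sup>2) = expectation (\<lambda>\<omega>. (T \<omega> - expectation T)\<^sup>2) / \<nu> ^ 4"
    unfolding Y by (simp add: power_divide power2_commute)
  also have "\<dots> \<le> (4 * real (card I) * real D ^ 3) / \<nu> ^ 4"
    by (intro divide_right_mono variance_T_le) simp
  also have "\<dots> = (4 * eps) * (D / \<nu>)"
    by (simp add: eps_def power3_eq_cube power2_eq_square eval_nat_numeral)
  also have "\<dots> \<le> (4 * eps) * eps"
    using eps_pos by (intro mult_left_mono D_div_nu_le) auto
  finally have V: "expectation (\<lambda>\<omega>. (?Y \<omega>)\<^sup>2) \<le> 4 * eps * eps" .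
  have "expectation (\<lambda>\<omega>. \<bar>?Y \<omega>\<bar>) \<le> expectation (\<lambda>\<omega>. (?Y \<omega>)\<^sup>2 / (4 * eps) + eps)"
  proof (rule integral_mono)
    show "integrable M (\<lambda>\<omega>. \<bar>?Y \<omega>\<bar>)" using integrable_T by (intro integrable_abs) auto
    show "integrable M (\<lambda>\<omega>. (?Y \<omega>)\<^sup>2 / (4 * eps) + eps)" using int by auto
    show "\<bar>?Y \<omega>\<bar> \<le> (?Y \<omega>)\<^sup>2 / (4 * eps) + eps" for \<omega>
      using sum_squares_bound[of "\<bar>?Y \<omega>\<bar>" "2 * eps"] eps_pos
      by (simp add: field_simps power2_eq_square)
  qed
  also have "\<dots> = expectation (\<lambda>\<omega>. (?Y \<omega>)\<^sup>2) / (4 * eps) + eps"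
    using int by (subst Bochner_Integration.integral_add) (auto simp: prob_space)
  also have "\<dots> \<le> 4 * eps * eps / (4 * eps) + eps"
    using V eps_pos by (intro add_mono divide_right_mono) auto
  also have "\<dots> = 2 * eps" using eps_pos by simp
  finally show ?thesis .
qed

definition discrepancy :: "real \<Rightarrow> real" where
  "discrepancy z = \<bar>prob {\<omega> \<in> space M. W \<omega> \<le> z} - cdf std_normal_distribution z\<bar>"

text \<open>Concentration of \<open>W\<close> is bought with the quantity under study: an interval has its normal
probability up to an error of at most \<open>2 * \<kappa>\<close>.\<close>

lemma prob_W_interval_le:
  assumes \<kappa>: "\<And>z. discrepancy z \<le> \<kappa>" and "a \<le> c"
  shows "expectation (\<lambda>\<omega>. indicator {a<..c} (W \<omega>)) \<le> 2 / 5 * (c - a) + 2 * \<kappa>"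
proof -
  have "expectation (\<lambda>\<omega>. indicator {a<..c} (W \<omega>)) = expectation (indicator {\<omega> \<in> space M. a < W \<omega> \<and> W \<omega> \<le> c})"
    by (intro Bochner_Integration.integral_cong) (auto simp: indicator_def)
  also have "\<dots> = prob {\<omega> \<in> space M. a < W \<omega> \<and> W \<omega> \<le> c}" by simp
  also have "{\<omega> \<in> space M. a < W \<omega> \<and> W \<omega> \<le> c} = {\<omega> \<in> space M. W \<omega> \<le> c} - {\<omega> \<in> space M. W \<omega> \<le> a}"
    by auto
  also have "prob \<dots> = prob {\<omega> \<in> space M. W \<omega> \<le> c} - prob {\<omega> \<in> space M. W \<omega> \<le> a}"
    using \<open>a \<le> c\<close> by (intro finite_measure_Diff) auto
  also have "\<dots> \<le> 2 / 5 * (c - a) + 2 * \<kappa>"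
    using cdf_std_normal_diff_le[OF \<open>a \<le> c\<close>] \<kappa>[of a] \<kappa>[of c]
    unfolding discrepancy_def by linarith
  finally show ?thesis .
qed

text \<open>Each term of \<open>E (W * f W)\<close> is unchanged when \<open>f W\<close> is replaced by the increment
\<open>f W - f (W - \<eta> i)\<close>, because the subtracted part is uncorrelated with \<open>X i\<close>. The linear parts
\<open>\<eta> i * f' W\<close> of the increments add up to \<open>T / \<nu>\<^sup>2 * f' W\<close>; what remains is the Taylor remainder.\<close>

lemma stein_decomposition:
  assumes f [measurable]: "f \<in> borel_measurable borel" and F: "\<And>x. \<bar>f x\<bar> \<le> B"
    and f' [measurable]: "f' \<in> borel_measurable borel" and F': "\<And>x. \<bar>f' x\<bar> \<le> B'"
  shows "expectation (\<lambda>\<omega>. f' (W \<omega>)) - expectation (\<lambda>\<omega>. W \<omega> * f (W \<omega>))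
    = expectation (\<lambda>\<omega>. (1 - T \<omega> / \<nu>\<^sup>2) * f' (W \<omega>))
      - (\<Sum>i\<in>I. expectation (\<lambda>\<omega>. X i \<omega> * (f (W \<omega>) - f (W \<omega> - \<eta> i \<omega>) - \<eta> i \<omega> * f' (W \<omega>)))) / \<nu>"
proof -
  have fW: "integrable M (\<lambda>\<omega>. Y \<omega> * u (Z \<omega>))"
    if "random_variable borel Y" "\<And>\<omega>. \<omega> \<in> space M \<Longrightarrow> \<bar>Y \<omega>\<bar> \<le> C"
       "u \<in> borel_measurable borel" "\<And>x. \<bar>u x\<bar> \<le> C'" "random_variable borel Z"
    for Y Z :: "'a \<Rightarrow> real" and u C C'
  proof (rule bounded_integrable)
    show "random_variable borel (\<lambda>\<omega>. Y \<omega> * u (Z \<omega>))" using that by simp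
    show "\<bar>Y \<omega> * u (Z \<omega>)\<bar> \<le> C * C'" if "\<omega> \<in> space M" for \<omega>
      unfolding abs_mult using \<open>\<And>\<omega>. \<omega> \<in> space M \<Longrightarrow> \<bar>Y \<omega>\<bar> \<le> C\<close>[OF that] \<open>\<And>x. \<bar>u x\<bar> \<le> C'\<close>[of "Z \<omega>"]
      by (intro mult_mono) auto
  qed
  have X: "random_variable borel (X i)" "\<And>\<omega>. \<omega> \<in> space M \<Longrightarrow> \<bar>X i \<omega>\<bar> \<le> 1" if "i \<in> I" for i
    using rv bounded that by auto
  have e: "random_variable borel (\<lambda>\<omega>. W \<omega> - \<eta> i \<omega>)" if "i \<in> I" for i
    using eta_meas[OF that] by simp
  have X\<eta>: "\<bar>X i \<omega> * \<eta> i \<omega>\<bar> \<le> 1 * (D / \<nu>)" if "i \<in> I" "\<omega> \<in> space M" for i \<omega>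
    unfolding abs_mult using bounded[OF that] abs_eta_le[OF that] by (intro mult_mono) auto
  have X\<eta>m: "random_variable borel (\<lambda>\<omega>. X i \<omega> * \<eta> i \<omega>)" if "i \<in> I" for i
    using rv[OF that] eta_meas[OF that] by simp
  have far: "expectation (\<lambda>\<omega>. X i \<omega> * f (W \<omega> - \<eta> i \<omega>)) = 0" if "i \<in> I" for i
    using expectation_mult_far_zero[OF that f F, of \<nu>] by (simp add: W_def \<eta>_def diff_divide_distrib)
  have "expectation (\<lambda>\<omega>. X i \<omega> * (f (W \<omega>) - f (W \<omega> - \<eta> i \<omega>) - \<eta> i \<omega> * f' (W \<omega>)))
      = expectation (\<lambda>\<omega>. X i \<omega> * f (W \<omega>)) - expectation (\<lambda>\<omega>. X i \<omega> * \<eta> i \<omega> * f' (W \<omega>))" if i: "i \<in> I" for i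
  proof -
    have "expectation (\<lambda>\<omega>. X i \<omega> * (f (W \<omega>) - f (W \<omega> - \<eta> i \<omega>) - \<eta> i \<omega> * f' (W \<omega>)))
      = expectation (\<lambda>\<omega>. X i \<omega> * f (W \<omega>) - X i \<omega> * f (W \<omega> - \<eta> i \<omega>) - X i \<omega> * \<eta> i \<omega> * f' (W \<omega>))"
      by (simp add: algebra_simps)
    also have "\<dots> = expectation (\<lambda>\<omega>. X i \<omega> * f (W \<omega>)) - expectation (\<lambda>\<omega>. X i \<omega> * f (W \<omega> - \<eta> i \<omega>))
        - expectation (\<lambda>\<omega>. X i \<omega> * \<eta> i \<omega> * f' (W \<omega>))"
      using fW[OF X[OF i] f F W_meas] fW[OF X[OF i] f F e[OF i]]
        fW[OF X\<eta>m[OF i] X\<eta>[OF i] f' F' W_meas]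
      by simp
    finally show ?thesis by (simp add: far[OF i])
  qed
  then have "(\<Sum>i\<in>I. expectation (\<lambda>\<omega>. X i \<omega> * (f (W \<omega>) - f (W \<omega> - \<eta> i \<omega>) - \<eta> i \<omega> * f' (W \<omega>))))
      = (\<Sum>i\<in>I. expectation (\<lambda>\<omega>. X i \<omega> * f (W \<omega>)) - expectation (\<lambda>\<omega>. X i \<omega> * \<eta> i \<omega> * f' (W \<omega>)))"
    by (rule sum.cong[OF refl])
  also have "\<dots> = expectation (\<lambda>\<omega>. \<Sum>i\<in>I. X i \<omega> * f (W \<omega>)) - expectation (\<lambda>\<omega>. \<Sum>i\<in>I. X i \<omega> * \<eta> i \<omega> * f' (W \<omega>))"
    unfolding sum_subtractf using fW[OF X f F W_meas] fW[OF X\<eta>m X\<eta> f' F' W_meas]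
    by (subst (1 2) Bochner_Integration.integral_sum) auto
  also have "(\<lambda>\<omega>. \<Sum>i\<in>I. X i \<omega> * f (W \<omega>)) = (\<lambda>\<omega>. \<nu> * (W \<omega> * f (W \<omega>)))"
    using nu_pos by (simp add: fun_eq_iff W_def S_def sum_distrib_right[symmetric])
  also have "(\<lambda>\<omega>. \<Sum>i\<in>I. X i \<omega> * \<eta> i \<omega> * f' (W \<omega>)) = (\<lambda>\<omega>. \<nu> * (T \<omega> / \<nu>\<^sup>2 * f' (W \<omega>)))"
  proof
    fix \<omega>
    have "T \<omega> = (\<Sum>i\<in>I. \<Sum>j\<in>A i. X i \<omega> * X j \<omega>)"
      unfolding T_def using fin finite_nbhd by (intro sum.Sigma[symmetric]) auto
    also have "\<dots> = \<nu> * (\<Sum>i\<in>I. X i \<omega> * \<eta> i \<omega>)"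
      using nu_pos by (simp add: \<eta>_def sum_distrib_left[symmetric] sum_divide_distrib[symmetric])
    finally show "(\<Sum>i\<in>I. X i \<omega> * \<eta> i \<omega> * f' (W \<omega>)) = \<nu> * (T \<omega> / \<nu>\<^sup>2 * f' (W \<omega>))"
      using nu_pos by (simp add: sum_distrib_right[symmetric] power2_eq_square)
  qed
  finally have sum: "(\<Sum>i\<in>I. expectation (\<lambda>\<omega>. X i \<omega> * (f (W \<omega>) - f (W \<omega> - \<eta> i \<omega>) - \<eta> i \<omega> * f' (W \<omega>)))) / \<nu>
      = expectation (\<lambda>\<omega>. W \<omega> * f (W \<omega>)) - expectation (\<lambda>\<omega>. T \<omega> / \<nu>\<^sup>2 * f' (W \<omega>))"
    using nu_pos by (simp add: diff_divide_distrib)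
  have "integrable M (\<lambda>\<omega>. 1 * f' (W \<omega>))"
    by (rule fW[of _ 1]) (use F' in auto)
  moreover have "integrable M (\<lambda>\<omega>. T \<omega> / \<nu>\<^sup>2 * f' (W \<omega>))"
  proof -
    have m: "random_variable borel (\<lambda>\<omega>. T \<omega> / \<nu>\<^sup>2)" by measurable
    have "\<bar>T \<omega> / \<nu>\<^sup>2\<bar> \<le> card (Sigma I A) / \<nu>\<^sup>2" if "\<omega> \<in> space M" for \<omega>
      using abs_T_le[OF that] by (simp add: abs_divide divide_right_mono)
    from fW[OF m this f' F' W_meas] show ?thesis .
  qed
  ultimately have "expectation (\<lambda>\<omega>. (1 - T \<omega> / \<nu>\<^sup>2) * f' (W \<omega>))
      = expectation (\<lambda>\<omega>. f' (W \<omega>)) - expectation (\<lambda>\<omega>. T \<omega> / \<nu>\<^sup>2 * f' (W \<omega>))"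
    by (simp add: left_diff_distrib)
  then show ?thesis using sum by simp
qed

text \<open>The fluctuation of \<open>T\<close> contributes \<open>4 * eps\<close> and the smooth part of the Taylor remainder \<open>5 * eps\<close>.
The ramp contributes \<open>eps / d\<close> times the probability that \<open>W\<close> is near the slope.\<close>

lemma ramp_error_le:
  assumes \<kappa>: "\<And>z. discrepancy z \<le> \<kappa>" and d: "d > 0"
  shows "\<bar>expectation (\<lambda>\<omega>. ramp z d (W \<omega>)) - normal_mean (ramp z d)\<bar>
    \<le> 9 * eps + eps * (2 / 5 * (d + 2 * eps) + 2 * \<kappa>) / d"
proof -
  interpret R: stein_test "ramp z d" by (rule stein_test_ramp[OF d])
  let ?f = "stein_sol (ramp z d)" and ?f' = "R.stein_deriv" and ?b = "D / \<nu>"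
  let ?R = "\<lambda>i \<omega>. ?f (W \<omega>) - ?f (W \<omega> - \<eta> i \<omega>) - \<eta> i \<omega> * ?f' (W \<omega>)"
  let ?ind = "\<lambda>\<omega>. indicator {z - ?b<..z + d + ?b} (W \<omega>) :: real"
  have b0: "?b \<ge> 0" using nu_pos by simp
  have int_ramp: "integrable M (\<lambda>\<omega>. ramp z d (W \<omega>))"
    using R.nonneg R.le_one by (intro bounded_integrable[of _ 1]) auto
  have int_Wf: "integrable M (\<lambda>\<omega>. W \<omega> * ?f (W \<omega>))"
    using R.abs_mult_stein_sol_le by (intro bounded_integrable[of _ 1]) auto
  have "expectation (\<lambda>\<omega>. ?f' (W \<omega>))
      = expectation (\<lambda>\<omega>. ramp z d (W \<omega>)) - normal_mean (ramp z d) + expectation (\<lambda>\<omega>. W \<omega> * ?f (W \<omega>))"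
    unfolding R.stein_deriv_def using int_ramp int_Wf by (simp add: prob_space)
  then have eq: "expectation (\<lambda>\<omega>. ramp z d (W \<omega>)) - normal_mean (ramp z d)
      = expectation (\<lambda>\<omega>. (1 - T \<omega> / \<nu>\<^sup>2) * ?f' (W \<omega>)) - (\<Sum>i\<in>I. expectation (\<lambda>\<omega>. X i \<omega> * ?R i \<omega>)) / \<nu>"
    using stein_decomposition[OF R.stein_sol_meas R.abs_stein_sol_le R.stein_deriv_meas R.abs_stein_deriv_le]
    by simp
  have "\<bar>expectation (\<lambda>\<omega>. (1 - T \<omega> / \<nu>\<^sup>2) * ?f' (W \<omega>))\<bar>
      \<le> expectation (\<lambda>\<omega>. \<bar>(1 - T \<omega> / \<nu>\<^sup>2) * ?f' (W \<omega>)\<bar>)"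
    by (rule integral_abs_bound)
  also have "\<dots> \<le> expectation (\<lambda>\<omega>. 2 * \<bar>1 - T \<omega> / \<nu>\<^sup>2\<bar>)"
  proof (rule integral_mono')
    show "integrable M (\<lambda>\<omega>. 2 * \<bar>1 - T \<omega> / \<nu>\<^sup>2\<bar>)"
      using integrable_T by (intro integrable_mult_right integrable_abs) auto
    show "\<bar>(1 - T \<omega> / \<nu>\<^sup>2) * ?f' (W \<omega>)\<bar> \<le> 2 * \<bar>1 - T \<omega> / \<nu>\<^sup>2\<bar>" for \<omega>
      unfolding abs_mult using mult_left_mono[OF R.abs_stein_deriv_le[of "W \<omega>"], of "\<bar>1 - T \<omega> / \<nu>\<^sup>2\<bar>"]
      by simp
  qed simp
  also have "\<dots> \<le> 4 * eps" using expectation_abs_one_minus_T_le by simp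
  finally have first: "\<bar>expectation (\<lambda>\<omega>. (1 - T \<omega> / \<nu>\<^sup>2) * ?f' (W \<omega>))\<bar> \<le> 4 * eps" .
  have int_ind: "integrable M ?ind"
    by (intro bounded_integrable[of _ 1]) (auto simp: indicator_def)
  have "expectation (\<lambda>\<omega>. 2 * \<bar>W \<omega>\<bar> + 3 + ?ind \<omega> / d) = 2 * expectation (\<lambda>\<omega>. \<bar>W \<omega>\<bar>) + 3 + expectation ?ind / d"
    using integrable_abs_W int_ind by (simp add: prob_space)
  also have "\<dots> \<le> 2 * 1 + 3 + (2 / 5 * (d + 2 * eps) + 2 * \<kappa>) / d"
  proof (intro add_mono mult_left_mono divide_right_mono expectation_abs_W_le)
    have "expectation ?ind \<le> 2 / 5 * ((z + d + ?b) - (z - ?b)) + 2 * \<kappa>"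
      using d b0 by (intro prob_W_interval_le[OF \<kappa>]) simp
    also have "2 / 5 * ((z + d + ?b) - (z - ?b)) + 2 * \<kappa> \<le> 2 / 5 * (d + 2 * eps) + 2 * \<kappa>"
      using D_div_nu_le by (intro add_right_mono mult_left_mono) auto
    finally show "expectation ?ind \<le> 2 / 5 * (d + 2 * eps) + 2 * \<kappa>" .
  qed (use d in auto)
  finally have m: "expectation (\<lambda>\<omega>. 2 * \<bar>W \<omega>\<bar> + 3 + ?ind \<omega> / d) \<le> 5 + (2 / 5 * (d + 2 * eps) + 2 * \<kappa>) / d"
    (is "_ \<le> ?C") by simp
  have rem: "\<bar>expectation (\<lambda>\<omega>. X i \<omega> * ?R i \<omega>)\<bar> \<le> ?b\<^sup>2 * ?C" if i: "i \<in> I" for i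
  proof -
    have "\<bar>expectation (\<lambda>\<omega>. X i \<omega> * ?R i \<omega>)\<bar> \<le> expectation (\<lambda>\<omega>. \<bar>X i \<omega> * ?R i \<omega>\<bar>)"
      by (rule integral_abs_bound)
    also have "\<dots> \<le> expectation (\<lambda>\<omega>. ?b\<^sup>2 * (2 * \<bar>W \<omega>\<bar> + 3 + ?ind \<omega> / d))"
    proof (rule integral_mono')
      show "integrable M (\<lambda>\<omega>. ?b\<^sup>2 * (2 * \<bar>W \<omega>\<bar> + 3 + ?ind \<omega> / d))"
        using integrable_abs_W int_ind by simp
      fix \<omega> assume w: "\<omega> \<in> space M"
      have "\<bar>X i \<omega>\<bar> * \<bar>?R i \<omega>\<bar> \<le> 1 * (?b\<^sup>2 * (2 * \<bar>W \<omega>\<bar> + 3 + ?ind \<omega> / d))"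
        using bounded[OF i w] by (intro mult_mono stein_ramp_taylor[OF d abs_eta_le[OF i w]]) auto
      then show "\<bar>X i \<omega> * ?R i \<omega>\<bar> \<le> ?b\<^sup>2 * (2 * \<bar>W \<omega>\<bar> + 3 + ?ind \<omega> / d)"
        by (simp add: abs_mult)
      show "0 \<le> ?b\<^sup>2 * (2 * \<bar>W \<omega>\<bar> + 3 + ?ind \<omega> / d)"
        using d by (intro mult_nonneg_nonneg add_nonneg_nonneg) auto
    qed
    also have "\<dots> = ?b\<^sup>2 * expectation (\<lambda>\<omega>. 2 * \<bar>W \<omega>\<bar> + 3 + ?ind \<omega> / d)" by simp
    also have "\<dots> \<le> ?b\<^sup>2 * ?C" by (intro mult_left_mono m) simp
    finally show ?thesis .
  qed
  have "\<bar>(\<Sum>i\<in>I. expectation (\<lambda>\<omega>. X i \<omega> * ?R i \<omega>)) / \<nu>\<bar> \<le> (\<Sum>i\<in>I. ?b\<^sup>2 * ?C) / \<nu>"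
    unfolding abs_divide using nu_pos rem
    by (simp only: abs_of_pos, intro divide_right_mono order_trans[OF sum_abs] sum_mono) auto
  also have "\<dots> = eps * ?C"
    by (simp add: eps_def power3_eq_cube power2_eq_square)
  finally have "\<bar>expectation (\<lambda>\<omega>. ramp z d (W \<omega>)) - normal_mean (ramp z d)\<bar> \<le> 4 * eps + eps * ?C"
    using first eq by linarith
  then show ?thesis by (simp add: distrib_left)
qed

text \<open>With ramps of width \<open>d = 4 * eps\<close> the term \<open>2 * eps * \<kappa> / d\<close> becomes \<open>\<kappa> / 2\<close>. Placing the ramp to
the right or to the left of \<open>z\<close> bounds the distribution function from above or from below.\<close>

lemma discrepancy_self_bound:
  assumes \<kappa>: "\<And>z. discrepancy z \<le> \<kappa>"
  shows "discrepancy z \<le> 56 / 5 * eps + \<kappa> / 2"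
proof -
  define d where "d = 4 * eps"
  have d: "d > 0" using eps_pos by (simp add: d_def)
  have "9 * eps + eps * (2 / 5 * (d + 2 * eps) + 2 * \<kappa>) / d = 48 / 5 * eps + \<kappa> / 2"
    using eps_pos by (simp add: d_def field_simps)
  then have err: "\<bar>expectation (\<lambda>\<omega>. ramp y d (W \<omega>)) - normal_mean (ramp y d)\<bar> \<le> 48 / 5 * eps + \<kappa> / 2" for y
    using ramp_error_le[OF \<kappa> d, of y] by simp
  have ind: "prob {\<omega> \<in> space M. W \<omega> \<le> z} = expectation (\<lambda>\<omega>. indicator {..z} (W \<omega>))"
  proof -
    have "prob {\<omega> \<in> space M. W \<omega> \<le> z} = expectation (indicator {\<omega> \<in> space M. W \<omega> \<le> z})" by simp
    also have "\<dots> = expectation (\<lambda>\<omega>. indicator {..z} (W \<omega>))"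
      by (intro Bochner_Integration.integral_cong) (auto simp: indicator_def)
    finally show ?thesis .
  qed
  have int_ind: "integrable M (\<lambda>\<omega>. indicator {..z} (W \<omega>) :: real)"
    by (intro bounded_integrable[of _ 1]) (auto simp: indicator_def)
  have int_ramp: "integrable M (\<lambda>\<omega>. ramp y d (W \<omega>))" for y
  proof -
    interpret R: stein_test "ramp y d" by (rule stein_test_ramp[OF d])
    show ?thesis using R.nonneg R.le_one by (intro bounded_integrable[of _ 1]) auto
  qed
  have up: "prob {\<omega> \<in> space M. W \<omega> \<le> z} \<le> expectation (\<lambda>\<omega>. ramp z d (W \<omega>))"
    unfolding ind using d
    by (intro integral_mono int_ind int_ramp) (auto simp: indicator_def ramp_eq_one stein_test.nonneg[OF stein_test_ramp])
  have lo: "expectation (\<lambda>\<omega>. ramp (z - d) d (W \<omega>)) \<le> prob {\<omega> \<in> space M. W \<omega> \<le> z}"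
    unfolding ind using d
    by (intro integral_mono int_ind int_ramp) (auto simp: indicator_def ramp_eq_zero stein_test.le_one[OF stein_test_ramp])
  have "cdf std_normal_distribution (z + d) - cdf std_normal_distribution z \<le> 2 / 5 * d"
    "cdf std_normal_distribution z - cdf std_normal_distribution (z - d) \<le> 2 / 5 * d"
    using cdf_std_normal_diff_le[of z "z + d"] cdf_std_normal_diff_le[of "z - d" z] d by auto
  then have "discrepancy z \<le> (48 / 5 * eps + \<kappa> / 2) + 2 / 5 * d"
    using up lo err[of z] err[of "z - d"] cdf_le_normal_mean_ramp[OF d, of z]
      cdf_le_normal_mean_ramp[OF d, of "z - d"]
    unfolding discrepancy_def by (auto simp: abs_le_iff)
  then show ?thesis by (simp add: d_def)
qed

text \<open>The supremum \<open>\<kappa>\<close> of the discrepancies is finite, so \<open>\<kappa> \<le> 56/5 * eps + \<kappa> / 2\<close> can be solved for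
\<open>\<kappa>\<close>.\<close>

theorem discrepancy_le: "discrepancy z \<le> 112 / 5 * eps"
proof -
  define \<kappa> where "\<kappa> = (SUP z. discrepancy z)"
  interpret N: real_distribution std_normal_distribution by (rule real_dist_normal_dist)
  have bdd: "bdd_above (range discrepancy)"
  proof (rule bdd_aboveI2)
    show "discrepancy z \<le> 1" for z
      using N.cdf_bounded_prob[of z] N.cdf_nonneg[of z] prob_le_1[of "{\<omega> \<in> space M. W \<omega> \<le> z}"]
        measure_nonneg[of M "{\<omega> \<in> space M. W \<omega> \<le> z}"]
      unfolding discrepancy_def by linarith
  qed
  have \<kappa>: "discrepancy z \<le> \<kappa>" for z
    unfolding \<kappa>_def by (rule cSUP_upper[OF UNIV_I bdd])
  have "\<kappa> \<le> 56 / 5 * eps + \<kappa> / 2"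
    by (subst (1) \<kappa>_def, rule cSUP_least) (simp, rule discrepancy_self_bound[OF \<kappa>])
  then show ?thesis using \<kappa>[of z] by linarith
qed

end

section \<open>Exponential races\<close>

text \<open>The Luce weight of a list, in a form that peels off the first chosen item and thus matches
an induction on the race. The denominators are sums of what is left, as opposed to
differences from the total weight.\<close>

fun luce_list :: "('i \<Rightarrow> real) \<Rightarrow> 'i list \<Rightarrow> real" where
  "luce_list \<theta> [] = 1"
| "luce_list \<theta> (a # as) = \<theta> a / (\<Sum>b\<leftarrow>a # as. \<theta> b) * luce_list \<theta> as"

lemma luce_list_nonneg: "(\<And>a. \<theta> a > 0) \<Longrightarrow> luce_list \<theta> as \<ge> 0"
proof (induction as)
  case (Cons a as)
  have "(\<Sum>b\<leftarrow>a # as. \<theta> b) \<ge> 0" using Cons.prems by (intro sum_list_nonneg) (auto intro: less_imp_le)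
  moreover have "luce_list \<theta> as \<ge> 0" "\<theta> a \<ge> 0" using Cons by (auto intro: less_imp_le)
  ultimately show ?case unfolding luce_list.simps by (intro mult_nonneg_nonneg divide_nonneg_nonneg)
qed simp

lemma luce_list_upt:
  assumes "1 \<le> m" "m \<le> Suc k"
  shows "luce_list \<theta> (map f [m..<Suc k])
    = (\<Prod>j=m..k. \<theta> (f j) / ((\<Sum>i=1..k. \<theta> (f i)) - (\<Sum>i=1..<j. \<theta> (f i))))"
  using assms(2,1)
proof (induction m rule: inc_induct)
  case base
  then show ?case by simp
next
  case (step m)
  have "(\<Sum>i=1..k. \<theta> (f i)) = (\<Sum>i=1..<m. \<theta> (f i)) + (\<Sum>i=m..k. \<theta> (f i))"
    using step.hyps step.prems sum.atLeastLessThan_concat[of 1 m "Suc k" "\<lambda>i. \<theta> (f i)"]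
    by (simp add: atLeastLessThanSuc_atLeastAtMost)
  moreover have "(\<Sum>b\<leftarrow>map f [m..<Suc k]. \<theta> b) = (\<Sum>i=m..k. \<theta> (f i))"
    by (simp only: map_map interv_sum_list_conv_sum_set_nat set_upt atLeastLessThanSuc_atLeastAtMost o_def)
  ultimately have s: "(\<Sum>b\<leftarrow>map f [m..<Suc k]. \<theta> b) = (\<Sum>i=1..k. \<theta> (f i)) - (\<Sum>i=1..<m. \<theta> (f i))"
    by simp
  have u: "map f [m..<Suc k] = f m # map f [Suc m..<Suc k]"
    using step.hyps by (simp add: upt_conv_Cons del: upt_Suc)
  have "luce_list \<theta> (map f [m..<Suc k])
      = \<theta> (f m) / (\<Sum>b\<leftarrow>map f [m..<Suc k]. \<theta> b) * luce_list \<theta> (map f [Suc m..<Suc k])"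
    unfolding u by (rule luce_list.simps)
  moreover have "{m..k} = insert m {Suc m..k}" using step.hyps by auto
  ultimately show ?case unfolding s using step.IH step.prems by simp
qed

lemma luce_p_eq_luce_list: "luce_p k (\<lambda>j. \<theta> (f j)) = luce_list \<theta> (map f [1..<Suc k])"
  unfolding luce_p_def by (rule luce_list_upt[symmetric]) auto

text \<open>Conditioned on the first clock ringing at time \<open>y > t\<close>, the remaining clocks, of total rate \<open>c\<close>, are
all still running with probability \<open>exp (- (y * c))\<close>.\<close>

lemma nn_integral_exponential_tail:
  assumes l: "l > 0" and c: "c \<ge> 0" and t: "t \<ge> 0"
  shows "(\<integral>\<^sup>+y. indicator {t<..} y * ennreal (exp (- (y * c))) \<partial>density lborel (exponential_density l))
    = ennreal (l / (l + c) * exp (- (t * (l + c))))"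
proof -
  have lc: "l + c > 0" using l c by simp
  have "(\<integral>\<^sup>+y. indicator {t<..} y * ennreal (exp (- (y * c))) \<partial>density lborel (exponential_density l))
    = (\<integral>\<^sup>+y. ennreal (exponential_density l y) * (indicator {t<..} y * ennreal (exp (- (y * c)))) \<partial>lborel)"
    by (rule nn_integral_density) auto
  also have "\<dots> = (\<integral>\<^sup>+y. ennreal (l / (l + c)) * (ennreal (exponential_density (l + c) y) * indicator {t<..} y) \<partial>lborel)"
  proof (rule nn_integral_cong)
    fix y :: real
    have "l * exp (- y * l) * exp (- (y * c)) = l / (l + c) * ((l + c) * exp (- y * (l + c)))"
      using lc by (simp add: exp_add[symmetric] distrib_left)
    then show "ennreal (exponential_density l y) * (indicator {t<..} y * ennreal (exp (- (y * c))))
      = ennreal (l / (l + c)) * (ennreal (exponential_density (l + c) y) * indicator {t<..} y)"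
      using l c t by (auto simp: indicator_def exponential_density_def ennreal_mult[symmetric])
  qed
  also have "\<dots> = ennreal (l / (l + c)) * emeasure (density lborel (exponential_density (l + c))) {t<..}"
    by (simp add: nn_integral_cmult emeasure_density)
  also have "emeasure (density lborel (exponential_density (l + c))) {t<..} = ennreal (exp (- (t * (l + c))))"
  proof -
    let ?N = "density lborel (exponential_density (l + c))"
    interpret N: prob_space ?N by (rule prob_space_exponential_density[OF lc])
    have "distributed ?N lborel (\<lambda>x. x) (exponential_density (l + c))"
      unfolding distributed_def by (auto simp: distr_id2)
    from N.exponential_distributedD_gt[OF this t lc]
    have "measure ?N {t<..} = exp (- t * (l + c))" by (simp add: greaterThan_def)
    then show ?thesis by (simp add: N.emeasure_eq_measure)
  qed
  also have "ennreal (l / (l + c)) * ennreal (exp (- (t * (l + c)))) = ennreal (l / (l + c) * exp (- (t * (l + c))))"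
    using l lc by (simp only: ennreal_mult[symmetric] divide_nonneg_nonneg less_imp_le exp_ge_zero)
  finally show ?thesis .
qed

lemma sorted_chain_measurable [measurable]:
  assumes "set as \<subseteq> J"
  shows "Measurable.pred (PiM J (\<lambda>_. borel)) (\<lambda>x. sorted_wrt (<) (map x as :: real list))"
proof -
  have "sorted_wrt (<) (map x as) \<longleftrightarrow> (\<forall>i<length as. \<forall>j<length as. i < j \<longrightarrow> x (as ! i) < x (as ! j))"
    for x :: "'a \<Rightarrow> real"
    by (auto simp: sorted_wrt_iff_nth_less)
  moreover have "as ! i \<in> J" if "i < length as" for i using assms that by auto
  ultimately show ?thesis by simp
qed

text \<open>The race is restarted each time a clock rings, so the induction needs a general starting time
\<open>t\<close>: by memorylessness it only contributes the probability that all clocks are still running at \<open>t\<close>.\<close>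

lemma exponential_race:
  assumes "\<And>a. \<theta> a > 0" "distinct as" "t \<ge> 0"
  shows "(\<integral>\<^sup>+x. indicator {x. sorted_wrt (<) (t # map x as)} x
        \<partial>PiM (set as) (\<lambda>a. density lborel (exponential_density (\<theta> a))))
    = ennreal (luce_list \<theta> as * exp (- (t * (\<Sum>a\<leftarrow>as. \<theta> a))))"
  using assms(2,3)
proof (induction as arbitrary: t)
  case Nil
  then show ?case by (simp add: PiM_empty nn_integral_count_space_finite)
next
  case (Cons a as)
  let ?M = "\<lambda>a. density lborel (exponential_density (\<theta> a))"
  interpret P: product_prob_space ?M "set as"
    by (intro product_prob_spaceI prob_space_exponential_density assms)
  have a: "a \<notin> set as" "distinct as" using Cons.prems by auto
  let ?s = "\<Sum>a\<leftarrow>as. \<theta> a"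
  have nn: "luce_list \<theta> as \<ge> 0" by (intro luce_list_nonneg assms(1))
  have s: "?s \<ge> 0" using assms(1) by (intro sum_list_nonneg) (auto intro: less_imp_le)
  have "(\<integral>\<^sup>+x. indicator {x. sorted_wrt (<) (t # map x (a # as))} x \<partial>PiM (set (a # as)) ?M)
    = (\<integral>\<^sup>+x. indicator {x. t < x a \<and> sorted_wrt (<) (map x (a # as))} x \<partial>PiM (insert a (set as)) ?M)"
    by (intro arg_cong2[where f = nn_integral] arg_cong[where f = indicator]) (auto intro: less_trans)
  also have "\<dots> = (\<integral>\<^sup>+y. (\<integral>\<^sup>+x. indicator {x. t < x a \<and> sorted_wrt (<) (map x (a # as))} (x(a := y))
      \<partial>PiM (set as) ?M) \<partial>?M a)"
  proof (rule P.product_nn_integral_insert_rev[OF _ a(1)])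
    have *: "sets (PiM (insert a (set as)) ?M) = sets (PiM (insert a (set as)) (\<lambda>_. borel))"
      by (intro sets_PiM_cong) auto
    have [measurable]: "Measurable.pred (PiM (insert a (set as)) (\<lambda>_. borel))
        (\<lambda>x :: 'a \<Rightarrow> real. sorted_wrt (<) (map x (a # as)))"
      by (rule sorted_chain_measurable) auto
    have "(\<lambda>x :: 'a \<Rightarrow> real. indicator {x. t < x a \<and> sorted_wrt (<) (map x (a # as))} x :: ennreal)
        \<in> borel_measurable (PiM (insert a (set as)) (\<lambda>_. borel))"
      by (rule borel_measurable_indicator') measurable
    then show "(\<lambda>x. indicator {x. t < x a \<and> sorted_wrt (<) (map x (a # as))} x :: ennreal)
        \<in> borel_measurable (PiM (insert a (set as)) ?M)"
      unfolding measurable_cong_sets[OF * refl] .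
  qed simp
  also have "\<dots> = (\<integral>\<^sup>+y. indicator {t<..} y * (\<integral>\<^sup>+x. indicator {x. sorted_wrt (<) (y # map x as)} x
      \<partial>PiM (set as) ?M) \<partial>?M a)"
  proof (intro nn_integral_cong)
    fix y :: real
    have upd: "map (x(a := y)) as = map x as" for x using a(1) by (auto simp: fun_upd_def)
    show "(\<integral>\<^sup>+x. indicator {x. t < x a \<and> sorted_wrt (<) (map x (a # as))} (x(a := y)) \<partial>PiM (set as) ?M)
      = indicator {t<..} y * (\<integral>\<^sup>+x. indicator {x. sorted_wrt (<) (y # map x as)} x \<partial>PiM (set as) ?M)"
      using a(1) by (cases "t < y") (auto intro!: nn_integral_cong simp: indicator_def upd)
  qed
  also have "\<dots> = (\<integral>\<^sup>+y. ennreal (luce_list \<theta> as) * (indicator {t<..} y * ennreal (exp (- (y * ?s)))) \<partial>?M a)"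
  proof (intro nn_integral_cong)
    fix y :: real
    show "indicator {t<..} y * (\<integral>\<^sup>+x. indicator {x. sorted_wrt (<) (y # map x as)} x \<partial>PiM (set as) ?M)
      = ennreal (luce_list \<theta> as) * (indicator {t<..} y * ennreal (exp (- (y * ?s))))"
    proof (cases "t < y")
      case True
      then have "y \<ge> 0" using Cons.prems by simp
      from Cons.IH[OF a(2) this] show ?thesis
        using True nn assms(1) by (simp add: ennreal_mult)
    qed simp
  qed
  also have "\<dots> = ennreal (luce_list \<theta> as) * ennreal (\<theta> a / (\<theta> a + ?s) * exp (- (t * (\<theta> a + ?s))))"
    using nn_integral_exponential_tail[OF assms(1) s Cons.prems(2), of a]
    by (subst nn_integral_cmult) auto
  also have "\<dots> = ennreal (luce_list \<theta> (a # as) * exp (- (t * (\<Sum>a\<leftarrow>a # as. \<theta> a))))"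
    using nn assms(1) s
    by (simp add: ennreal_mult'[symmetric] mult_ac)
  finally show ?case .
qed

lemma AE_exponential_pos:
  assumes "l > 0"
  shows "AE x in density lborel (exponential_density l). x > 0"
proof -
  have "AE x in lborel. x \<noteq> (0::real)" by (rule AE_lborel_singleton)
  then have "AE x in lborel. 0 < ennreal (exponential_density l x) \<longrightarrow> x > 0"
    by eventually_elim (auto simp: exponential_density_def split: if_splits)
  then show ?thesis by (subst AE_density) auto
qed

lemma luce_list_cong: "(\<And>a. a \<in> set as \<Longrightarrow> \<theta> a = \<theta>' a) \<Longrightarrow> luce_list \<theta> as = luce_list \<theta>' as"
proof (induction as)
  case (Cons a as)
  then have "map \<theta> (a # as) = map \<theta>' (a # as)" by (intro map_cong) auto
  then have "(\<Sum>b\<leftarrow>a # as. \<theta> b) = (\<Sum>b\<leftarrow>a # as. \<theta>' b)" by (simp only:)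
  moreover have "luce_list \<theta> as = luce_list \<theta>' as" "\<theta> a = \<theta>' a" using Cons by auto
  ultimately show ?case by (simp only: luce_list.simps)
qed simp

text \<open>Clocks are almost surely positive, so starting the race at time \<open>0\<close> is no restriction.\<close>

lemma emeasure_exponential_race:
  assumes pos: "\<And>a. \<theta> a > 0" and "distinct as"
  shows "emeasure (PiM (set as) (\<lambda>a. density lborel (exponential_density (\<theta> a))))
      {x \<in> space (PiM (set as) (\<lambda>_. borel)). sorted_wrt (<) (map x as :: real list)}
    = ennreal (luce_list \<theta> as)"
proof -
  let ?M = "\<lambda>a. density lborel (exponential_density (\<theta> a))" and ?P = "PiM (set as) (\<lambda>_. borel)"
  interpret P: product_prob_space ?M "set as"
    by (intro product_prob_spaceI prob_space_exponential_density pos)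
  have sets: "sets (PiM (set as) ?M) = sets ?P" by (intro sets_PiM_cong) auto
  have "AE x in PiM (set as) ?M. \<forall>a\<in>set as. x a > 0"
    by (intro AE_finite_allI) (auto intro!: P.AE_component AE_exponential_pos pos)
  then have ae: "AE x in PiM (set as) ?M. indicator {x \<in> space ?P. sorted_wrt (<) (map x as)} x
      = (indicator {x. sorted_wrt (<) (0 # map x as)} x :: ennreal)"
    using AE_space by eventually_elim (auto simp: indicator_def sets_eq_imp_space_eq[OF sets])
  have "{x \<in> space ?P. sorted_wrt (<) (map x as)} \<in> sets (PiM (set as) ?M)"
    unfolding sets by (rule predE, rule sorted_chain_measurable) simp
  then have "emeasure (PiM (set as) ?M) {x \<in> space ?P. sorted_wrt (<) (map x as)}
    = (\<integral>\<^sup>+x. indicator {x \<in> space ?P. sorted_wrt (<) (map x as)} x \<partial>PiM (set as) ?M)" by simp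
  also have "\<dots> = (\<integral>\<^sup>+x. indicator {x. sorted_wrt (<) (0 # map x as)} x \<partial>PiM (set as) ?M)"
    by (rule nn_integral_cong_AE[OF ae])
  also have "\<dots> = ennreal (luce_list \<theta> as)"
    using exponential_race[OF pos \<open>distinct as\<close>, of 0] by simp
  finally show ?thesis .
qed

lemma (in prob_space) prob_exponential_race:
  assumes ind: "indep_vars (\<lambda>_. borel) E J"
    and dist: "\<And>i. i \<in> J \<Longrightarrow> distributed M lborel (E i) (exponential_density (\<theta> i))"
    and pos: "\<And>i. i \<in> J \<Longrightarrow> \<theta> i > 0"
    and as: "distinct as" "set as \<subseteq> J" "as \<noteq> []"
  shows "prob {\<omega> \<in> space M. sorted_wrt (<) (map (\<lambda>a. E a \<omega>) as)} = luce_list \<theta> as"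
proof -
  \<comment> \<open>The race on the product measure is stated for rates that are positive everywhere; rates outside
    \<open>J\<close> occur on neither side.\<close>
  define \<theta>' where "\<theta>' a = (if a \<in> J then \<theta> a else 1)" for a
  have pos': "\<theta>' a > 0" for a using pos by (simp add: \<theta>'_def)
  let ?P = "PiM (set as) (\<lambda>_. borel) :: ('b \<Rightarrow> real) measure"
  let ?X = "\<lambda>\<omega>. \<lambda>i\<in>set as. E i \<omega>"
  have rv: "random_variable borel (E i)" if "i \<in> J" for i
    using ind that by (auto simp: indep_vars_def2)
  have ind': "indep_vars (\<lambda>_. borel) E (set as)" using indep_vars_subset[OF ind as(2)] .
  have "distr M ?P ?X = PiM (set as) (\<lambda>i. distr M borel (E i))"
    using indep_vars_iff_distr_eq_PiM'[of "set as" E "\<lambda>_. borel"] ind' as rv by auto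
  also have "\<dots> = PiM (set as) (\<lambda>a. density lborel (exponential_density (\<theta>' a)))"
  proof (rule PiM_cong[OF refl])
    fix i assume "i \<in> set as"
    then have i: "i \<in> J" using as by auto
    have "distr M borel (E i) = distr M lborel (E i)" by (rule distr_cong) auto
    also have "\<dots> = density lborel (exponential_density (\<theta> i))"
      using dist[OF i] by (simp add: distributed_def)
    finally show "distr M borel (E i) = density lborel (exponential_density (\<theta>' i))"
      using i by (simp add: \<theta>'_def)
  qed
  finally have eq: "distr M ?P ?X = PiM (set as) (\<lambda>a. density lborel (exponential_density (\<theta>' a)))" .
  let ?A = "{x \<in> space ?P. sorted_wrt (<) (map x as)}"
  have X: "?X \<in> measurable M ?P" using rv as by (intro measurable_restrict) auto
  have A: "?A \<in> sets ?P" by (rule predE, rule sorted_chain_measurable) simp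
  have restr: "map (?X \<omega>) as = map (\<lambda>a. E a \<omega>) as" for \<omega> by simp
  have "{\<omega> \<in> space M. sorted_wrt (<) (map (\<lambda>a. E a \<omega>) as)} = ?X -` ?A \<inter> space M"
    using measurable_space[OF X] by (auto simp: restr)
  then have "emeasure M {\<omega> \<in> space M. sorted_wrt (<) (map (\<lambda>a. E a \<omega>) as)} = emeasure (distr M ?P ?X) ?A"
    using emeasure_distr[OF X A] by simp
  also have "\<dots> = ennreal (luce_list \<theta>' as)"
    unfolding eq by (rule emeasure_exponential_race[OF pos' as(1)])
  also have "luce_list \<theta>' as = luce_list \<theta> as"
    using as by (intro luce_list_cong) (auto simp: \<theta>'_def)
  finally have "emeasure M {\<omega> \<in> space M. sorted_wrt (<) (map (\<lambda>a. E a \<omega>) as)} = ennreal (luce_list \<theta> as)" .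
  moreover have "luce_list \<theta>' as \<ge> 0" by (intro luce_list_nonneg pos')
  then have "luce_list \<theta> as \<ge> 0" using \<open>luce_list \<theta>' as = luce_list \<theta> as\<close> by simp
  ultimately show ?thesis by (simp add: measure_def)
qed

section \<open>Consecutive occurrences as ordered windows\<close>

lemma ith_interval: "a \<in> {1..k} \<Longrightarrow> ith {Suc i..i + k} a = i + a"
proof -
  assume a: "a \<in> {1..k}"
  have "sorted_list_of_set {Suc i..i + k} = [Suc i..<Suc (i + k)]"
    by (metis atLeastLessThanSuc_atLeastAtMost sorted_list_of_set_range)
  then show ?thesis using a by (simp add: ith_def nth_append del: upt_Suc)
qed

text \<open>\<open>pat\<close> is the unique permutation in the same relative order as the window. Listing the positions of
the window by increasing \<open>\<pi>\<close>-value, that is along \<open>inv \<pi>\<close>, turns equality of two orders into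
monotonicity.\<close>

lemma pat_eq_iff:
  assumes \<pi>: "\<pi> permutes {1..k}" and \<sigma>: "inj \<sigma>"
  shows "pat {Suc i..i + k} \<sigma> = \<pi> \<longleftrightarrow> strict_mono_on {1..k} (\<lambda>j. \<sigma> (i + inv \<pi> j))"
proof -
  let ?Q = "\<lambda>\<tau>. \<forall>a\<in>{1..k}. \<forall>b\<in>{1..k}. \<tau> a < \<tau> b \<longleftrightarrow> \<sigma> (i + a) < \<sigma> (i + b)"
  let ?I = "{Suc i..i + k}"
  have ex: "\<exists>!\<tau>. \<tau> permutes {1..card ?I} \<and>
     (\<forall>a\<in>{1..card ?I}. \<forall>b\<in>{1..card ?I}. \<tau> a < \<tau> b \<longleftrightarrow> \<sigma> (ith ?I a) < \<sigma> (ith ?I b))"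
    by (rule pat_ex1) (use \<sigma> inj_on_subset in auto)
  have "pat ?I \<sigma> = \<pi> \<longleftrightarrow> ?Q \<pi>"
    unfolding pat_def using theI'[OF ex] the1_equality[OF ex, of \<pi>] \<pi> by (auto simp: ith_interval)
  also have "\<dots> \<longleftrightarrow> strict_mono_on {1..k} (\<lambda>j. \<sigma> (i + inv \<pi> j))"
  proof
    assume Q: "?Q \<pi>"
    show "strict_mono_on {1..k} (\<lambda>j. \<sigma> (i + inv \<pi> j))"
    proof (rule strict_mono_onI)
      fix u v assume uv: "u \<in> {1..k}" "v \<in> {1..k}" "u < v"
      have "inv \<pi> u \<in> {1..k}" "inv \<pi> v \<in> {1..k}"
        using uv permutes_in_image[OF permutes_inv[OF \<pi>]] by blast+
      moreover have "\<pi> (inv \<pi> u) < \<pi> (inv \<pi> v)" using uv permutes_inverses[OF \<pi>] by simp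
      ultimately show "\<sigma> (i + inv \<pi> u) < \<sigma> (i + inv \<pi> v)" using Q by blast
    qed
  next
    assume S: "strict_mono_on {1..k} (\<lambda>j. \<sigma> (i + inv \<pi> j))"
    show "?Q \<pi>"
    proof (intro ballI)
      fix a b assume ab: "a \<in> {1..k}" "b \<in> {1..k}"
      then have "\<pi> a \<in> {1..k}" "\<pi> b \<in> {1..k}" using permutes_in_image[OF \<pi>] by blast+
      from strict_mono_on_less[OF S this] show "\<pi> a < \<pi> b \<longleftrightarrow> \<sigma> (i + a) < \<sigma> (i + b)"
        using permutes_inverses[OF \<pi>] by simp
    qed
  qed
  finally show ?thesis .
qed

lemma c_occ_eq_sum:
  assumes k: "k \<ge> 1" "k \<le> n" and \<pi>: "\<pi> permutes {1..k}" and \<sigma>: "inj \<sigma>"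
  shows "real (c_occ k \<pi> n \<sigma>)
    = (\<Sum>i=0..n - k. of_bool (strict_mono_on {1..k} (\<lambda>j. \<sigma> (i + inv \<pi> j))))"
proof -
  let ?P = "\<lambda>i. strict_mono_on {1..k} (\<lambda>j. \<sigma> (i + inv \<pi> j))"
  have "{I. I \<subseteq> {1..n} \<and> card I = k \<and> (\<exists>a b. I = {a..b}) \<and> pat I \<sigma> = \<pi>}
      = (\<lambda>i. {Suc i..i + k}) ` {i \<in> {0..n - k}. ?P i}" (is "?L = ?R")
  proof (intro equalityI subsetI)
    fix I assume "I \<in> ?L"
    then obtain a b where I: "I = {a..b}" "{a..b} \<subseteq> {1..n}" "card {a..b} = k" "pat I \<sigma> = \<pi>"
      by blast
    then have "a \<le> b" using k by (cases "a \<le> b") auto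
    then have "1 \<le> a" "b \<le> n" "b = (a - 1) + k" "a = Suc (a - 1)" using I by auto
    then have "I = {Suc (a - 1)..(a - 1) + k}" "a - 1 \<le> n - k" using I(1) by auto
    then show "I \<in> ?R" using I(4) pat_eq_iff[OF \<pi> \<sigma>] by auto
  next
    fix I assume "I \<in> ?R"
    then show "I \<in> ?L" using k pat_eq_iff[OF \<pi> \<sigma>] by auto
  qed
  moreover have "inj_on (\<lambda>i. {Suc i..i + k}) {i \<in> {0..n - k}. ?P i}"
    using k by (intro inj_onI) auto
  ultimately have "c_occ k \<pi> n \<sigma> = card {i \<in> {0..n - k}. ?P i}"
    unfolding c_occ_def by (simp only: card_image)
  then show ?thesis by (simp add: sum.If_cases of_bool_def Int_def)
qed

section \<open>Windows of exponential clocks\<close>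

lemma strict_mono_on_iff_sorted_wrt:
  fixes g :: "nat \<Rightarrow> 'a :: linorder"
  shows "strict_mono_on {1..k} g \<longleftrightarrow> sorted_wrt (<) (map g [1..<Suc k])"
proof
  assume "strict_mono_on {1..k} g"
  then show "sorted_wrt (<) (map g [1..<Suc k])"
    by (auto simp: sorted_wrt_iff_nth_less strict_mono_on_def simp del: upt_Suc)
next
  assume S: "sorted_wrt (<) (map g [1..<Suc k])"
  show "strict_mono_on {1..k} g"
  proof (rule strict_mono_onI)
    fix r s assume "r \<in> {1..k}" "s \<in> {1..k}" "r < s"
    then show "g r < g s"
      using sorted_wrt_nth_less[OF S, of "r - 1" "s - 1"] by (simp del: upt_Suc)
  qed
qed

text \<open>Disjoint events whose probabilities sum to \<open>1\<close> cover the sample space up to a null set. Applied to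
the rankings of the clocks, this null set contains all ties.\<close>

lemma (in prob_space) expectation_on_events:
  fixes Y :: "'a \<Rightarrow> real"
  assumes fin: "finite F" and B: "\<And>\<tau>. \<tau> \<in> F \<Longrightarrow> B \<tau> \<in> events"
    and disj: "disjoint_family_on B F"
    and total: "(\<Sum>\<tau>\<in>F. prob (B \<tau>)) = 1"
    and Y: "\<And>\<tau> \<omega>. \<tau> \<in> F \<Longrightarrow> \<omega> \<in> B \<tau> \<Longrightarrow> Y \<omega> = y \<tau>"
    and meas: "random_variable borel Y"
  shows "expectation Y = (\<Sum>\<tau>\<in>F. prob (B \<tau>) * y \<tau>)"
proof -
  have "prob (\<Union>\<tau>\<in>F. B \<tau>) = 1"
    using finite_measure_finite_Union[OF fin _ disj] B total by auto
  then have ae: "AE \<omega> in M. \<omega> \<in> (\<Union>\<tau>\<in>F. B \<tau>)"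
    using B fin by (intro AE_in_set_eq_1[THEN iffD2]) auto
  have ind: "(\<Sum>\<tau>\<in>F. indicator (B \<tau>) \<omega> * y \<tau>) = y \<rho>" if "\<rho> \<in> F" "\<omega> \<in> B \<rho>" for \<rho> \<omega>
  proof -
    have "(\<Sum>\<tau>\<in>F. indicator (B \<tau>) \<omega> * y \<tau>) = (\<Sum>\<tau>\<in>F. if \<tau> = \<rho> then y \<rho> else 0)"
      using disj that by (intro sum.cong refl) (auto simp: indicator_def disjoint_family_on_def)
    then show ?thesis using that fin by simp
  qed
  have "AE \<omega> in M. Y \<omega> = (\<Sum>\<tau>\<in>F. indicator (B \<tau>) \<omega> * y \<tau>)"
    by (rule AE_mp[OF ae], rule AE_I2) (auto simp: Y ind)
  then have "expectation Y = expectation (\<lambda>\<omega>. \<Sum>\<tau>\<in>F. indicator (B \<tau>) \<omega> * y \<tau>)"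
    using B meas by (intro integral_cong_AE) auto
  also have "\<dots> = (\<Sum>\<tau>\<in>F. expectation (\<lambda>\<omega>. indicator (B \<tau>) \<omega> * y \<tau>))"
  proof (rule Bochner_Integration.integral_sum)
    show "integrable M (\<lambda>\<omega>. indicator (B \<tau>) \<omega> * y \<tau>)" if "\<tau> \<in> F" for \<tau>
      by (intro integrable_mult_left integrable_real_indicator B that) (simp add: emeasure_eq_measure)
  qed
  also have "\<dots> = (\<Sum>\<tau>\<in>F. prob (B \<tau>) * y \<tau>)"
    using B by (intro sum.cong refl) simp
  finally show ?thesis .
qed

text \<open>The clocks are kept abstract: the variance formula concerns every such family, while the normal
approximation needs one concrete family.\<close>

locale exponential_race_windows = prob_space N for N :: "'a measure" +
  fixes E :: "nat \<Rightarrow> 'a \<Rightarrow> real" and \<theta> :: "nat \<Rightarrow> real" and k n :: nat and \<pi> :: "nat \<Rightarrow> nat"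
  assumes ind: "indep_vars (\<lambda>_. borel) E {1..n}"
    and dist: "i \<in> {1..n} \<Longrightarrow> distributed N lborel (E i) (exponential_density (\<theta> i))"
    and pos: "i \<in> {1..n} \<Longrightarrow> \<theta> i > 0"
    and k: "1 \<le> k" "k \<le> n" and \<pi>: "\<pi> permutes {1..k}"
begin

definition ordered_at :: "nat \<Rightarrow> (nat \<Rightarrow> real) \<Rightarrow> bool" where
  "ordered_at i x \<longleftrightarrow> strict_mono_on {1..k} (\<lambda>j. x (i + inv \<pi> j))"

definition p :: "nat \<Rightarrow> real" where "p i = luce_p k (\<lambda>j. \<theta> (i + inv \<pi> j))"

definition G :: "'a \<Rightarrow> real" where "G \<omega> = (\<Sum>i=0..n - k. of_bool (ordered_at i (\<lambda>a. E a \<omega>)))"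

definition X :: "nat \<Rightarrow> 'a \<Rightarrow> real" where "X i \<omega> = of_bool (ordered_at i (\<lambda>a. E a \<omega>)) - p i"

definition overlapping :: "nat \<Rightarrow> nat set" where "overlapping i = {j \<in> {0..n - k}. j < i + k \<and> i < j + k}"

lemma E_meas: "i \<in> {1..n} \<Longrightarrow> random_variable borel (E i)"
  using ind by (auto simp: indep_vars_def2)

lemma inv_\<pi>: "j \<in> {1..k} \<Longrightarrow> inv \<pi> j \<in> {1..k}"
  using permutes_in_image[OF permutes_inv[OF \<pi>]] by blast

lemma ordered_at_measurable:
  assumes "{Suc i..i + k} \<subseteq> J"
  shows "Measurable.pred (PiM J (\<lambda>_. borel)) (ordered_at i)"
proof -
  have "Measurable.pred (PiM J (\<lambda>_. borel)) (\<lambda>x. sorted_wrt (<) (map x (map (\<lambda>j. i + inv \<pi> j) [1..<Suc k]) :: real list))"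
  proof (rule sorted_chain_measurable)
    show "set (map (\<lambda>j. i + inv \<pi> j) [1..<Suc k]) \<subseteq> J"
      using assms inv_\<pi> by (force simp del: upt_Suc)
  qed
  then show ?thesis unfolding ordered_at_def[abs_def] strict_mono_on_iff_sorted_wrt map_map o_def .
qed

lemma ordered_at_restrict:
  assumes "{Suc i..i + k} \<subseteq> J"
  shows "ordered_at i (\<lambda>a\<in>J. x a) = ordered_at i x"
proof -
  have "(\<lambda>a\<in>J. x a) (i + inv \<pi> j) = x (i + inv \<pi> j)" if "j \<in> {1..k}" for j
    using inv_\<pi>[OF that] subsetD[OF assms, of "i + inv \<pi> j"] by simp
  then show ?thesis unfolding ordered_at_def strict_mono_on_def by auto
qed

lemma ordered_at_event_measurable:
  assumes i: "i \<le> n - k"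
  shows "Measurable.pred N (\<lambda>\<omega>. ordered_at i (\<lambda>a. E a \<omega>))"
proof -
  have sub: "{Suc i..i + k} \<subseteq> {1..n}" using i k by auto
  have "(\<lambda>\<omega>. \<lambda>a\<in>{1..n}. E a \<omega>) \<in> measurable N (PiM {1..n} (\<lambda>_. borel))"
    using E_meas by (intro measurable_restrict) auto
  from measurable_compose[OF this ordered_at_measurable[OF sub]]
  show ?thesis by (simp only: ordered_at_restrict[OF sub])
qed

text \<open>One statement serves the windows, with \<open>m = k\<close>, and full rankings, with \<open>m = n\<close>.\<close>

lemma prob_chain:
  assumes "inj_on f {1..m}" "f ` {1..m} \<subseteq> {1..n}" "1 \<le> m"
  shows "prob {\<omega> \<in> space N. strict_mono_on {1..m} (\<lambda>j. E (f j) \<omega>)} = luce_p m (\<lambda>j. \<theta> (f j))"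
proof -
  have "prob {\<omega> \<in> space N. sorted_wrt (<) (map (\<lambda>a. E a \<omega>) (map f [1..<Suc m]))}
      = luce_list \<theta> (map f [1..<Suc m])"
  proof (rule prob_exponential_race[OF ind dist pos])
    have "set [1..<Suc m] = {1..m}" by (simp only: set_upt atLeastLessThanSuc_atLeastAtMost)
    then show "distinct (map f [1..<Suc m])" "set (map f [1..<Suc m]) \<subseteq> {1..n}"
      using assms by (simp_all only: distinct_map distinct_upt set_map)
    show "map f [1..<Suc m] \<noteq> []" using assms(3) by simp
  qed
  then show ?thesis unfolding luce_p_eq_luce_list strict_mono_on_iff_sorted_wrt by (simp only: map_map o_def)
qed

lemma prob_ordered_at:
  assumes "i \<le> n - k"
  shows "prob {\<omega> \<in> space N. ordered_at i (\<lambda>a. E a \<omega>)} = p i"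
  unfolding ordered_at_def p_def
proof (rule prob_chain[where f = "\<lambda>j. i + inv \<pi> j"])
  show "inj_on (\<lambda>j. i + inv \<pi> j) {1..k}"
    using permutes_inj[OF permutes_inv[OF \<pi>]] by (auto simp: inj_on_def)
  show "(\<lambda>j. i + inv \<pi> j) ` {1..k} \<subseteq> {1..n}"
    using inv_\<pi> assms k by fastforce
qed (rule k)

lemma expectation_ordered_at:
  assumes "i \<le> n - k"
  shows "expectation (\<lambda>\<omega>. of_bool (ordered_at i (\<lambda>a. E a \<omega>))) = p i"
proof -
  have "expectation (\<lambda>\<omega>. of_bool (ordered_at i (\<lambda>a. E a \<omega>)) :: real) = expectation (indicator {\<omega> \<in> space N. ordered_at i (\<lambda>a. E a \<omega>)})"
    by (intro Bochner_Integration.integral_cong) (auto simp: indicator_def)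
  also have "\<dots> = prob {\<omega> \<in> space N. ordered_at i (\<lambda>a. E a \<omega>)}"
    using ordered_at_event_measurable[OF assms] by (simp add: Int_absorb2)
  finally show ?thesis using prob_ordered_at[OF assms] by simp
qed

lemma ordered_at_meas:
  assumes "i \<le> n - k"
  shows "random_variable borel (\<lambda>\<omega>. of_bool (ordered_at i (\<lambda>a. E a \<omega>)) :: real)"
proof -
  note ordered_at_event_measurable[OF assms, measurable]
  have "(\<lambda>\<omega>. if ordered_at i (\<lambda>a. E a \<omega>) then 1 else 0 :: real) \<in> borel_measurable N" by measurable
  then show ?thesis by (simp add: of_bool_def)
qed

lemma p_bounds: "i \<le> n - k \<Longrightarrow> 0 \<le> p i \<and> p i \<le> 1"
  using prob_ordered_at[of i] by (metis measure_nonneg prob_le_1)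

text \<open>Windows that start at distance at least \<open>k\<close> read disjoint sets of clocks, so the neighbours of \<open>i\<close>
are windows starting less than \<open>k\<close> away.\<close>

sublocale dependency_neighbourhoods N "{0..n - k}" X overlapping "2 * k"
proof unfold_locales
  fix i assume "i \<in> {0..n - k}"
  then have i: "i \<le> n - k" by simp
  show "random_variable borel (X i)" unfolding X_def[abs_def] using ordered_at_meas[OF i] by simp
  show "\<bar>X i \<omega>\<bar> \<le> 1" for \<omega> using p_bounds[OF i] by (auto simp: X_def)
  have "integrable N (\<lambda>\<omega>. of_bool (ordered_at i (\<lambda>a. E a \<omega>)) :: real)"
    using ordered_at_meas[OF i] by (intro integrable_const_bound[of _ 1]) auto
  then show "expectation (X i) = 0"
    unfolding X_def[abs_def] using expectation_ordered_at[OF i] by (simp add: prob_space)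
  show "overlapping i \<subseteq> {0..n - k}" by (auto simp: overlapping_def)
  show "i \<in> overlapping i" using i k by (auto simp: overlapping_def)
  show "j \<in> overlapping i \<Longrightarrow> i \<in> overlapping j" for j using i by (auto simp: overlapping_def)
  have "overlapping i \<subseteq> {i - k..<i + k}" by (auto simp: overlapping_def)
  then have "card (overlapping i) \<le> card {i - k..<i + k}" by (intro card_mono) auto
  then show "card (overlapping i) \<le> 2 * k" by simp
next
  fix K L assume K: "K \<subseteq> {0..n - k}" and L: "L \<subseteq> {0..n - k}" and sep: "\<And>i. i \<in> K \<Longrightarrow> overlapping i \<inter> L = {}"
  let ?J = "\<lambda>K. \<Union>i\<in>K. {Suc i..i + k}"
  let ?g = "\<lambda>K x. \<lambda>i\<in>K. of_bool (ordered_at i x) - p i"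
  have sub: "?J K \<subseteq> {1..n}" if "K \<subseteq> {0..n - k}" for K using that k by fastforce
  have disj: "?J K \<inter> ?J L = {}"
  proof (rule ccontr)
    assume "?J K \<inter> ?J L \<noteq> {}"
    then obtain i j a where "i \<in> K" "j \<in> L" "a \<in> {Suc i..i + k}" "a \<in> {Suc j..j + k}" by blast
    then have "j \<in> overlapping i" using L by (auto simp: overlapping_def)
    then show False using sep[OF \<open>i \<in> K\<close>] \<open>j \<in> L\<close> by blast
  qed
  have g: "?g K \<in> measurable (PiM (?J K) (\<lambda>_. borel)) (PiM K (\<lambda>_. borel))" for K
  proof (rule measurable_restrict)
    fix i assume "i \<in> K"
    then have "{Suc i..i + k} \<subseteq> ?J K" by auto
    note ordered_at_measurable[OF this, measurable]
    have "(\<lambda>x. (if ordered_at i x then 1 else 0) - p i) \<in> borel_measurable (PiM (?J K) (\<lambda>_. borel))" by measurable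
    then show "(\<lambda>x. of_bool (ordered_at i x) - p i) \<in> borel_measurable (PiM (?J K) (\<lambda>_. borel))"
      by (simp add: of_bool_def)
  qed
  have comp: "?g K \<circ> (\<lambda>\<omega>. \<lambda>a\<in>?J K. E a \<omega>) = (\<lambda>\<omega>. \<lambda>i\<in>K. X i \<omega>)" for K
  proof (intro ext)
    fix \<omega> i
    have "ordered_at i (\<lambda>a\<in>?J K. E a \<omega>) = ordered_at i (\<lambda>a. E a \<omega>)" if "i \<in> K"
      using that by (intro ordered_at_restrict) auto
    then show "(?g K \<circ> (\<lambda>\<omega>. \<lambda>a\<in>?J K. E a \<omega>)) \<omega> i = (\<lambda>i\<in>K. X i \<omega>) i"
      by (auto simp: X_def)
  qed
  show "indep_var (PiM K (\<lambda>_. borel)) (\<lambda>\<omega>. \<lambda>i\<in>K. X i \<omega>) (PiM L (\<lambda>_. borel)) (\<lambda>\<omega>. \<lambda>i\<in>L. X i \<omega>)"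
    using indep_var_compose[OF indep_var_restrict[OF ind disj sub[OF K] sub[OF L]] g g]
    unfolding comp .
qed simp

lemma S_eq: "S \<omega> = G \<omega> - (\<Sum>i=0..n - k. p i)"
  by (simp add: S_def G_def X_def sum_subtractf)

lemma G_meas [measurable]: "random_variable borel G"
  unfolding G_def[abs_def] by (intro borel_measurable_sum ordered_at_meas) simp

lemma expectation_G: "expectation G = (\<Sum>i=0..n - k. p i)"
proof -
  have "integrable N (\<lambda>\<omega>. of_bool (ordered_at i (\<lambda>a. E a \<omega>)) :: real)" if "i \<le> n - k" for i
    using ordered_at_meas[OF that] by (intro integrable_const_bound[of _ 1]) auto
  then show ?thesis
    unfolding G_def[abs_def] by (subst Bochner_Integration.integral_sum) (auto simp: expectation_ordered_at)
qed

lemma expectation_pair: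
  assumes "i \<le> n - k" "j \<le> n - k"
  shows "expectation (\<lambda>\<omega>. X i \<omega> * X j \<omega>)
    = prob {\<omega> \<in> space N. ordered_at i (\<lambda>a. E a \<omega>) \<and> ordered_at j (\<lambda>a. E a \<omega>)} - p i * p j"
proof -
  let ?A = "\<lambda>i. {\<omega> \<in> space N. ordered_at i (\<lambda>a. E a \<omega>)}"
  have A: "?A i \<in> events" "?A j \<in> events" "?A i \<inter> ?A j \<in> events"
    using ordered_at_event_measurable assms by (auto intro!: predE sets.Int)
  have "expectation (\<lambda>\<omega>. X i \<omega> * X j \<omega>)
      = expectation (\<lambda>\<omega>. indicator (?A i \<inter> ?A j) \<omega> - p j * indicator (?A i) \<omega> - p i * indicator (?A j) \<omega> + p i * p j)"
    by (intro Bochner_Integration.integral_cong) (auto simp: X_def indicator_def algebra_simps)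
  also have "\<dots> = prob (?A i \<inter> ?A j) - p j * prob (?A i) - p i * prob (?A j) + p i * p j"
    using A by (simp add: prob_space emeasure_eq_measure)
  also have "\<dots> = prob (?A i \<inter> ?A j) - p i * p j" using assms by (simp add: prob_ordered_at)
  also have "?A i \<inter> ?A j = {\<omega> \<in> space N. ordered_at i (\<lambda>a. E a \<omega>) \<and> ordered_at j (\<lambda>a. E a \<omega>)}" by auto
  finally show ?thesis .
qed

text \<open>Ordered pairs of overlapping windows are split into the diagonal and the two halves above and below
it. The halves contribute equally, and the upper one is indexed by the shift \<open>h = j - i\<close> between the
windows, which runs from \<open>1\<close> to \<open>k - 1\<close>.\<close>

lemma expectation_S_sq_formula:
  "expectation (\<lambda>\<omega>. (S \<omega>)\<^sup>2) = (\<Sum>i=0..n - k. p i - (p i)\<^sup>2) +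
    2 * (\<Sum>h=1..k - 1. \<Sum>i | i + h + k \<le> n.
      prob {\<omega> \<in> space N. ordered_at i (\<lambda>a. E a \<omega>) \<and> ordered_at (i + h) (\<lambda>a. E a \<omega>)} - p i * p (i + h))"
proof -
  let ?c = "\<lambda>(i, j). expectation (\<lambda>\<omega>. X i \<omega> * X j \<omega>)"
  let ?P = "Sigma {0..n - k} overlapping" and ?H = "Sigma {1..k - 1} (\<lambda>h. {i. i + h + k \<le> n})"
  have finP: "finite ?P" by (auto simp: overlapping_def)
  have finH: "finite {i. i + h + k \<le> n}" for h
    by (rule finite_subset[of _ "{0..n}"]) auto
  have sym: "?c (prod.swap q) = ?c q" for q
    by (cases q) (simp add: mult.commute)
  have less: "(\<Sum>q | q \<in> ?P \<and> fst q < snd q. ?c q) = (\<Sum>(h, i)\<in>?H. ?c (i, i + h))"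
    by (rule sum.reindex_bij_witness[where i = "\<lambda>(h, i). (i, i + h)" and j = "\<lambda>(i, j). (j - i, i)"])
       (use k in \<open>auto simp: overlapping_def\<close>)
  have "{q. q \<in> ?P \<and> snd q < fst q} = prod.swap ` {q. q \<in> ?P \<and> fst q < snd q}"
    by (force simp: overlapping_def)
  then have "(\<Sum>q | q \<in> ?P \<and> snd q < fst q. ?c q) = (\<Sum>q | q \<in> ?P \<and> fst q < snd q. ?c (prod.swap q))"
    by (simp only: sum.reindex[OF inj_on_subset[OF inj_swap[of UNIV] subset_UNIV]] o_def)
  then have greater: "(\<Sum>q | q \<in> ?P \<and> snd q < fst q. ?c q) = (\<Sum>(h, i)\<in>?H. ?c (i, i + h))"
    using less by (simp only: sym)
  \<comment> \<open>Every window overlaps itself because \<open>k\<close> is positive.\<close>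
  have diag: "(\<Sum>q | q \<in> ?P \<and> fst q = snd q. ?c q) = (\<Sum>i=0..n - k. ?c (i, i))"
    by (rule sum.reindex_bij_witness[where i = "\<lambda>i. (i, i)" and j = fst])
       (use k in \<open>auto simp: overlapping_def\<close>)
  have "expectation (\<lambda>\<omega>. (S \<omega>)\<^sup>2) = (\<Sum>q\<in>?P. ?c q)" by (rule expectation_S_sq)
  also have "\<dots> = (\<Sum>q | q \<in> ?P \<and> fst q = snd q. ?c q)
      + ((\<Sum>q | q \<in> ?P \<and> fst q < snd q. ?c q) + (\<Sum>q | q \<in> ?P \<and> snd q < fst q. ?c q))"
  proof -
    let ?D = "{q. q \<in> ?P \<and> fst q = snd q}" and ?L = "{q. q \<in> ?P \<and> fst q < snd q}"
      and ?R = "{q. q \<in> ?P \<and> snd q < fst q}"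
    have fin': "finite ?D" "finite ?L" "finite ?R"
      by (rule finite_subset[OF _ finP], blast)+
    have "?P = ?D \<union> (?L \<union> ?R)" by auto
    then have "sum ?c ?P = sum ?c (?D \<union> (?L \<union> ?R))" by (rule arg_cong)
    also have "\<dots> = sum ?c ?D + sum ?c (?L \<union> ?R)"
      using fin' by (intro sum.union_disjoint) auto
    also have "sum ?c (?L \<union> ?R) = sum ?c ?L + sum ?c ?R"
      using fin' by (intro sum.union_disjoint) auto
    finally show ?thesis .
  qed
  also have "\<dots> = (\<Sum>i=0..n - k. ?c (i, i)) + 2 * (\<Sum>(h, i)\<in>?H. ?c (i, i + h))"
    unfolding less greater diag by simp
  also have "(\<Sum>(h, i)\<in>?H. ?c (i, i + h)) = (\<Sum>h=1..k - 1. \<Sum>i | i + h + k \<le> n. ?c (i, i + h))"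
    using finH by (intro sum.Sigma[symmetric]) auto
  also have "\<dots> = (\<Sum>h=1..k - 1. \<Sum>i | i + h + k \<le> n.
      prob {\<omega> \<in> space N. ordered_at i (\<lambda>a. E a \<omega>) \<and> ordered_at (i + h) (\<lambda>a. E a \<omega>)} - p i * p (i + h))"
    by (intro sum.cong refl) (auto simp: expectation_pair)
  also have "(\<Sum>i=0..n - k. ?c (i, i)) = (\<Sum>i=0..n - k. p i - (p i)\<^sup>2)"
    by (intro sum.cong refl) (simp add: expectation_pair prob_ordered_at power2_eq_square)
  finally show ?thesis .
qed

text \<open>The event that \<open>\<tau> a\<close> is the rank of clock \<open>a\<close> for every \<open>a\<close>, without ties.\<close>

definition ranking :: "(nat \<Rightarrow> nat) \<Rightarrow> 'a set" where
  "ranking \<tau> = {\<omega> \<in> space N. strict_mono_on {1..n} (\<lambda>j. E (inv \<tau> j) \<omega>)}"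

lemma ranking_order:
  assumes \<tau>: "\<tau> permutes {1..n}" and \<omega>: "\<omega> \<in> ranking \<tau>" and ab: "a \<in> {1..n}" "b \<in> {1..n}"
  shows "E a \<omega> < E b \<omega> \<longleftrightarrow> \<tau> a < \<tau> b"
proof -
  have S: "strict_mono_on {1..n} (\<lambda>j. E (inv \<tau> j) \<omega>)" using \<omega> by (simp add: ranking_def)
  have "\<tau> a \<in> {1..n}" "\<tau> b \<in> {1..n}" using permutes_in_image[OF \<tau>] ab by blast+
  from strict_mono_on_less[OF S this] show ?thesis using permutes_inverses[OF \<tau>] by simp
qed

lemma disjoint_rankings: "disjoint_family_on ranking {\<tau>. \<tau> permutes {1..n}}"
  unfolding disjoint_family_on_def
proof (intro ballI impI)
  fix \<tau> \<rho> assume *: "\<tau> \<in> {\<tau>. \<tau> permutes {1..n}}" "\<rho> \<in> {\<tau>. \<tau> permutes {1..n}}" "\<tau> \<noteq> \<rho>"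
  show "ranking \<tau> \<inter> ranking \<rho> = {}"
  proof (rule ccontr)
    assume "ranking \<tau> \<inter> ranking \<rho> \<noteq> {}"
    then obtain \<omega> where \<omega>: "\<omega> \<in> ranking \<tau>" "\<omega> \<in> ranking \<rho>" by blast
    have "inj_on \<tau> {1..n}" using * by (simp add: permutes_inj_on)
    from permutes_same_order_ex1[OF this] have "\<rho> = \<tau>"
      using * ranking_order[OF _ \<omega>(1)] ranking_order[OF _ \<omega>(2)] by auto
    then show False using * by simp
  qed
qed

lemma G_on_ranking:
  assumes \<tau>: "\<tau> permutes {1..n}" and \<omega>: "\<omega> \<in> ranking \<tau>"
  shows "G \<omega> = real (c_occ k \<pi> n \<tau>)"
  unfolding G_def c_occ_eq_sum[OF k \<pi> permutes_inj[OF \<tau>]]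
proof (intro sum.cong refl arg_cong[where f = of_bool])
  fix i assume i: "i \<in> {0..n - k}"
  have "i + inv \<pi> j \<in> {1..n}" if "j \<in> {1..k}" for j using inv_\<pi>[OF that] i k by auto
  then show "ordered_at i (\<lambda>a. E a \<omega>) \<longleftrightarrow> strict_mono_on {1..k} (\<lambda>j. \<tau> (i + inv \<pi> j))"
    using ranking_order[OF \<tau> \<omega>] unfolding ordered_at_def strict_mono_on_def by blast
qed

lemma prob_ranking:
  assumes \<tau>: "\<tau> permutes {1..n}"
  shows "prob (ranking \<tau>) = luce_p n (\<lambda>j. \<theta> (inv \<tau> j))"
  unfolding ranking_def
  using permutes_inj_on[OF permutes_inv[OF \<tau>]] permutes_image[OF permutes_inv[OF \<tau>]] k
  by (intro prob_chain) auto

lemma ranking_measurable: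
  assumes \<tau>: "\<tau> permutes {1..n}"
  shows "ranking \<tau> \<in> events"
proof -
  have "E (inv \<tau> j) \<in> borel_measurable N" if "j \<in> {1..n}" for j
    using E_meas permutes_in_image[OF permutes_inv[OF \<tau>], of j] that by blast
  note this[measurable]
  have "ranking \<tau> = {\<omega> \<in> space N. \<forall>r\<in>{1..n}. \<forall>s\<in>{1..n}. r < s \<longrightarrow> E (inv \<tau> r) \<omega> < E (inv \<tau> s) \<omega>}"
    by (auto simp: ranking_def strict_mono_on_def)
  also have "\<dots> \<in> events" by measurable
  finally show ?thesis .
qed

text \<open>A ranking event has the same probability as the corresponding value of the Luce permutation, and
both statistics are determined by it in the same way. The values of the permutation have total
probability \<open>1\<close>, hence so do the rankings, which takes care of ties.\<close>

lemma expectation_luce_eq: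
  fixes M :: "'m measure" and h :: "real \<Rightarrow> real"
  assumes M: "prob_space M" and luce: "luce_distributed M n \<theta> \<sigma>" and h: "h \<in> borel_measurable borel"
  shows "prob_space.expectation M (\<lambda>\<omega>. h (real (c_occ k \<pi> n (\<sigma> \<omega>)))) = expectation (\<lambda>\<omega>. h (G \<omega>))"
proof -
  interpret M: prob_space M by (rule M)
  let ?F = "{\<tau>. \<tau> permutes {1..n}}" and ?B = "\<lambda>\<tau>. {\<omega> \<in> space M. \<sigma> \<omega> = \<tau>}"
  have fin: "finite ?F" by (rule finite_permutations) simp
  have \<sigma>: "\<sigma> \<in> measurable M (count_space ?F)" using luce by (simp add: luce_distributed_def)
  have B: "?B \<tau> \<in> M.events" if "\<tau> \<in> ?F" for \<tau>
    using measurable_sets[OF \<sigma>, of "{\<tau>}"] that by (simp add: vimage_def Int_def conj_commute)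
  have disj: "disjoint_family_on ?B ?F" by (auto simp: disjoint_family_on_def)
  have "(\<Union>\<tau>\<in>?F. ?B \<tau>) = space M" using measurable_space[OF \<sigma>] by auto
  then have total: "(\<Sum>\<tau>\<in>?F. M.prob (?B \<tau>)) = 1"
    using M.finite_measure_finite_Union[OF fin _ disj] B M.prob_space by auto
  have eq: "M.prob (?B \<tau>) = prob (ranking \<tau>)" if "\<tau> \<in> ?F" for \<tau>
    using luce that by (simp add: luce_distributed_def prob_ranking)
  have "M.expectation (\<lambda>\<omega>. h (real (c_occ k \<pi> n (\<sigma> \<omega>))))
      = (\<Sum>\<tau>\<in>?F. M.prob (?B \<tau>) * h (real (c_occ k \<pi> n \<tau>)))"
  proof (rule M.expectation_on_events[OF fin B disj total])
    show "M.random_variable borel (\<lambda>\<omega>. h (real (c_occ k \<pi> n (\<sigma> \<omega>))))"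
      by (rule measurable_compose[OF \<sigma>]) simp
  qed auto
  also have "\<dots> = (\<Sum>\<tau>\<in>?F. prob (ranking \<tau>) * h (real (c_occ k \<pi> n \<tau>)))"
    using eq by (intro sum.cong refl) simp
  also have "\<dots> = expectation (\<lambda>\<omega>. h (G \<omega>))"
  proof (rule expectation_on_events[OF fin _ disjoint_rankings, symmetric])
    show "(\<Sum>\<tau>\<in>?F. prob (ranking \<tau>)) = 1" using total eq by simp
    show "random_variable borel (\<lambda>\<omega>. h (G \<omega>))" using h by measurable
  qed (auto simp: G_on_ranking ranking_measurable)
  finally show ?thesis .
qed

lemma variance_luce_eq:
  assumes M: "prob_space M" and luce: "luce_distributed M n \<theta> \<sigma>"
  shows "prob_space.variance M (\<lambda>\<omega>. real (c_occ k \<pi> n (\<sigma> \<omega>))) = expectation (\<lambda>\<omega>. (S \<omega>)\<^sup>2)"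
  using expectation_luce_eq[OF M luce, of "\<lambda>x. x"]
    expectation_luce_eq[OF M luce, of "\<lambda>x. (x - (\<Sum>i=0..n - k. p i))\<^sup>2"]
  by (simp add: expectation_G S_eq)

lemma berry_esseen_luce:
  fixes \<nu> w :: real
  assumes M: "prob_space M" and luce: "luce_distributed M n \<theta> \<sigma>"
    and \<nu>: "\<nu>\<^sup>2 = prob_space.variance M (\<lambda>\<omega>. real (c_occ k \<pi> n (\<sigma> \<omega>)))" "\<nu> > 0"
  shows "\<bar>measure M {\<omega> \<in> space M. (real (c_occ k \<pi> n (\<sigma> \<omega>))
        - prob_space.expectation M (\<lambda>\<omega>. real (c_occ k \<pi> n (\<sigma> \<omega>)))) / \<nu> \<le> w}
      - cdf std_normal_distribution w\<bar>
    \<le> 32 * (1 + sqrt 6) * (real n * (real k)\<^sup>2 / \<nu> ^ 3)"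
proof -
  interpret M: prob_space M by (rule M)
  interpret Z: standardized_sum N "{0..n - k}" X overlapping "2 * k" \<nu>
    using \<nu> by unfold_locales (simp_all add: variance_luce_eq[OF M luce])
  define c where "c = (\<Sum>i=0..n - k. p i)"
  let ?C = "\<lambda>\<omega>. real (c_occ k \<pi> n (\<sigma> \<omega>))"
  have mean: "M.expectation ?C = c"
    using expectation_luce_eq[OF M luce, of "\<lambda>x. x"] by (simp add: expectation_G c_def)
  have C: "?C \<in> borel_measurable M"
  proof -
    have "\<sigma> \<in> measurable M (count_space {\<tau>. \<tau> permutes {1..n}})"
      using luce by (simp add: luce_distributed_def)
    from measurable_compose[OF this, of "\<lambda>\<tau>. real (c_occ k \<pi> n \<tau>)" borel] show ?thesis by simp
  qed
  have [measurable]: "{x. (x - c) / \<nu> \<le> w} \<in> sets borel" by measurable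
  note C[measurable]
  have "measure M {\<omega> \<in> space M. (?C \<omega> - c) / \<nu> \<le> w} = M.expectation (indicator {\<omega> \<in> space M. (?C \<omega> - c) / \<nu> \<le> w})"
    by simp
  also have "\<dots> = M.expectation (\<lambda>\<omega>. indicator {x. (x - c) / \<nu> \<le> w} (?C \<omega>))"
    by (intro Bochner_Integration.integral_cong) (auto simp: indicator_def)
  also have "\<dots> = expectation (\<lambda>\<omega>. indicator {x. (x - c) / \<nu> \<le> w} (G \<omega>))"
    using expectation_luce_eq[OF M luce, of "indicator {x. (x - c) / \<nu> \<le> w}"] by simp
  also have "\<dots> = expectation (indicator {\<omega> \<in> space N. Z.W \<omega> \<le> w})"
    by (intro Bochner_Integration.integral_cong) (auto simp: indicator_def Z.W_def S_eq c_def)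
  also have "\<dots> = prob {\<omega> \<in> space N. Z.W \<omega> \<le> w}" by simp
  finally have "\<bar>measure M {\<omega> \<in> space M. (?C \<omega> - M.expectation ?C) / \<nu> \<le> w} - cdf std_normal_distribution w\<bar>
      = Z.discrepancy w"
    by (simp add: mean Z.discrepancy_def)
  also have "\<dots> \<le> 112 / 5 * Z.eps" by (rule Z.discrepancy_le)
  also have "\<dots> = 448 / 5 * (real (n - k + 1) * (real k)\<^sup>2 / \<nu> ^ 3)"
    by (simp add: Z.eps_def power2_eq_square)
  also have "\<dots> \<le> 32 * (1 + sqrt 6) * (real n * (real k)\<^sup>2 / \<nu> ^ 3)"
  proof (rule mult_mono)
    have "2 \<le> sqrt 6" by (rule real_le_rsqrt) simp
    then show "448 / 5 \<le> 32 * (1 + sqrt 6)" by simp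
    show "real (n - k + 1) * (real k)\<^sup>2 / \<nu> ^ 3 \<le> real n * (real k)\<^sup>2 / \<nu> ^ 3"
      using k \<nu> by (intro divide_right_mono mult_right_mono of_nat_mono) auto
  qed (use \<nu> in auto)
  finally show ?thesis .
qed

end

text \<open>Existence of independent variables with prescribed distributions, as the coordinates of a product
measure.\<close>

lemma indep_vars_PiM_coordinates:
  assumes "\<And>i. prob_space (M i)" "\<And>i. sets (M i) = sets borel" "I \<noteq> {}"
  shows "prob_space.indep_vars (PiM I M) (\<lambda>_. borel) (\<lambda>i x. x i) I"
    and "i \<in> I \<Longrightarrow> distr (PiM I M) borel (\<lambda>x. x i) = M i"
proof -
  interpret P: product_prob_space M I by (intro product_prob_spaceI assms)
  have comp: "distr (PiM I M) borel (\<lambda>x. x i) = M i" if "i \<in> I" for i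
  proof -
    have "distr (PiM I M) borel (\<lambda>x. x i) = distr (PiM I M) (M i) (\<lambda>x. x i)"
      by (rule distr_cong) (simp_all add: assms)
    then show ?thesis using P.PiM_component[OF that] by simp
  qed
  then show "i \<in> I \<Longrightarrow> distr (PiM I M) borel (\<lambda>x. x i) = M i" .
  have rv: "(\<lambda>x. x i) \<in> borel_measurable (PiM I M)" if "i \<in> I" for i
    using measurable_component_singleton[OF that, of M] assms(2)
    by (simp cong: measurable_cong_sets)
  have sets: "sets (PiM I (\<lambda>_. borel)) = sets (PiM I M)"
    by (intro sets_PiM_cong) (simp_all add: assms)
  have "distr (PiM I M) (PiM I (\<lambda>_. borel)) (\<lambda>x. \<lambda>i\<in>I. x i) = distr (PiM I M) (PiM I M) (\<lambda>x. x)"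
    by (rule distr_cong) (auto simp: sets space_PiM PiE_restrict)
  also have "\<dots> = PiM I M" by (simp add: distr_id2)
  also have "\<dots> = PiM I (\<lambda>i. distr (PiM I M) borel (\<lambda>x. x i))"
    using comp by (intro PiM_cong) auto
  finally show "P.P.indep_vars (\<lambda>_. borel) (\<lambda>i x. x i) I"
    using P.indep_vars_iff_distr_eq_PiM'[OF assms(3) rv] by simp
qed


theorem theorem3p2:
  fixes k n :: nat and \<pi> :: "nat \<Rightarrow> nat" and \<theta> :: "nat \<Rightarrow> real"
    and M :: "'a measure" and \<sigma>\<^sub>n :: "'a \<Rightarrow> nat \<Rightarrow> nat"
    and p :: "nat \<Rightarrow> real" and \<nu> :: real
  assumes "k \<ge> 1" and "\<pi> permutes {1..k}" and "n \<ge> k"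
    and "\<And>i. i \<in> {1..n} \<Longrightarrow> \<theta> i > 0"
    and "prob_space M" and "luce_distributed M n \<theta> \<sigma>\<^sub>n"
    and "\<And>i. i \<le> n - k \<Longrightarrow> p i = luce_p k (\<lambda>j. \<theta> (i + inv \<pi> j))"
    and "\<nu>\<^sup>2 = prob_space.variance M (\<lambda>\<omega>. real (c_occ k \<pi> n (\<sigma>\<^sub>n \<omega>)))" and "\<nu> \<ge> 0"
  shows "(\<forall>(N :: 'b measure) E.
            prob_space N \<and> prob_space.indep_vars N (\<lambda>_. borel) E {1..n} \<and>
            (\<forall>i\<in>{1..n}. distributed N lborel (E i) (exponential_density (\<theta> i))) \<longrightarrow>
            \<nu>\<^sup>2 = (\<Sum>i=0..n-k. p i - (p i)\<^sup>2) +
              2 * (\<Sum>h=1..k-1. \<Sum>i | i + h + k \<le> n.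
                     measure N {\<omega> \<in> space N.
                       strict_mono_on {1..k} (\<lambda>j. E (i + inv \<pi> j) \<omega>) \<and>
                       strict_mono_on {1..k} (\<lambda>j. E (i + h + inv \<pi> j) \<omega>)}
                     - p i * p (i + h))) \<and>
         (\<nu> > 0 \<longrightarrow>
           (\<forall>w::real.
             \<bar>measure M {\<omega> \<in> space M.
                 (real (c_occ k \<pi> n (\<sigma>\<^sub>n \<omega>))
                    - prob_space.expectation M (\<lambda>\<omega>. real (c_occ k \<pi> n (\<sigma>\<^sub>n \<omega>)))) / \<nu> \<le> w}
               - cdf std_normal_distribution w\<bar>
             \<le> 32 * (1 + sqrt 6) * (real n * (real k)\<^sup>2 / \<nu> ^ 3)))"
proof (intro conjI allI impI)
  fix N :: "'b measure" and E
  assume N: "prob_space N \<and> prob_space.indep_vars N (\<lambda>_. borel) E {1..n} \<and>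
    (\<forall>i\<in>{1..n}. distributed N lborel (E i) (exponential_density (\<theta> i)))"
  then interpret N: prob_space N by simp
  interpret R: exponential_race_windows N E \<theta> k n \<pi>
    using N assms by unfold_locales auto
  have p: "p i = R.p i" if "i \<le> n - k" for i using assms(7)[OF that] by (simp add: R.p_def)
  have diag: "(\<Sum>i=0..n-k. p i - (p i)\<^sup>2) = (\<Sum>i=0..n-k. R.p i - (R.p i)\<^sup>2)"
    by (intro sum.cong refl) (simp add: p)
  have off: "(\<Sum>h=1..k-1. \<Sum>i | i + h + k \<le> n.
        measure N {\<omega> \<in> space N. strict_mono_on {1..k} (\<lambda>j. E (i + inv \<pi> j) \<omega>) \<and>
          strict_mono_on {1..k} (\<lambda>j. E (i + h + inv \<pi> j) \<omega>)} - p i * p (i + h))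
      = (\<Sum>h=1..k-1. \<Sum>i | i + h + k \<le> n.
        measure N {\<omega> \<in> space N. R.ordered_at i (\<lambda>a. E a \<omega>) \<and> R.ordered_at (i + h) (\<lambda>a. E a \<omega>)} - R.p i * R.p (i + h))"
    by (intro sum.cong refl) (simp add: p R.ordered_at_def)
  show "\<nu>\<^sup>2 = (\<Sum>i=0..n-k. p i - (p i)\<^sup>2) +
      2 * (\<Sum>h=1..k-1. \<Sum>i | i + h + k \<le> n.
        measure N {\<omega> \<in> space N. strict_mono_on {1..k} (\<lambda>j. E (i + inv \<pi> j) \<omega>) \<and>
          strict_mono_on {1..k} (\<lambda>j. E (i + h + inv \<pi> j) \<omega>)} - p i * p (i + h))"
    unfolding diag off
    using R.variance_luce_eq[OF assms(5,6)] assms(8) R.expectation_S_sq_formula by simp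
next
  fix w assume \<nu>: "\<nu> > 0"
  \<comment> \<open>Rate \<open>1\<close> outside \<open>{1..n}\<close> is a default: the product locale asks for a probability measure at
    every index.\<close>
  define \<mu> where "\<mu> i = density lborel (exponential_density (if i \<in> {1..n} then \<theta> i else 1))" for i :: nat
  have \<mu>: "prob_space (\<mu> i)" "sets (\<mu> i) = sets borel" for i
    unfolding \<mu>_def using assms(4) by (auto intro!: prob_space_exponential_density)
  have ne: "{1..n} \<noteq> {}" using assms(1,3) by simp
  interpret R: exponential_race_windows "PiM {1..n} \<mu>" "\<lambda>i x. x i" \<theta> k n \<pi>
  proof (intro exponential_race_windows.intro exponential_race_windows_axioms.intro assms)
    show "prob_space (PiM {1..n} \<mu>)" by (rule prob_space_PiM) (rule \<mu>)
    show "prob_space.indep_vars (PiM {1..n} \<mu>) (\<lambda>_. borel) (\<lambda>i x. x i) {1..n}"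
      by (rule indep_vars_PiM_coordinates(1)[where M = \<mu>, OF \<mu> ne])
    fix i assume i: "i \<in> {1..n}"
    have "distr (PiM {1..n} \<mu>) lborel (\<lambda>x. x i) = distr (PiM {1..n} \<mu>) borel (\<lambda>x. x i)"
      by (rule distr_cong) auto
    also have "\<dots> = density lborel (exponential_density (\<theta> i))"
      using indep_vars_PiM_coordinates(2)[where M = \<mu> and i = i, OF \<mu> ne i] i
      by (simp only: \<mu>_def if_True)
    finally show "distributed (PiM {1..n} \<mu>) lborel (\<lambda>x. x i) (exponential_density (\<theta> i))"
      using measurable_component_singleton[OF i, of \<mu>] \<mu>(2)
      by (simp add: distributed_def cong: measurable_cong_sets)
  qed
  show "\<bar>measure M {\<omega> \<in> space M. (real (c_occ k \<pi> n (\<sigma>\<^sub>n \<omega>))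
        - prob_space.expectation M (\<lambda>\<omega>. real (c_occ k \<pi> n (\<sigma>\<^sub>n \<omega>)))) / \<nu> \<le> w}
      - cdf std_normal_distribution w\<bar>
    \<le> 32 * (1 + sqrt 6) * (real n * (real k)\<^sup>2 / \<nu> ^ 3)"
    by (rule R.berry_esseen_luce[OF assms(5,6,8) \<nu>])
qed

end
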